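(* Let $\beta\ge 1$, let $L=\{(0:0:x_2:x_3)\}\subset\mathbb{P}^3$, and let $X\subset\mathbb{P}^3$ be the rational curve of degree $\beta$ with parametrization $$\mathbb{P}^1\to X,\qquad (s:t)\mapsto\bigl(s f(s,t):t f(s,t):g(s,t):h(s,t)\bigr),$$ where $f,g,h$ are binary forms of degrees $\beta-1,\beta,\beta$ respectively, $f\neq0$. Let $C$ be the $(1,\beta)$-congruence of lines that intersect both $L$ and $X$. Then the rational camera $\mathbb{P}^3\dashrightarrow C$, sending a generic point $x$ to the unique line $C(x)$ of $C$ through $x$, is given by $$C(x)\;=\;\begin{bmatrix} {x_0} \\ {x_1} \\ {x_2} \\ {x_3} \end{bmatrix}\;\vee\;\begin{bmatrix} {x_0}f(x_0,x_1) \\ {x_1}f(x_0,x_1) \\ {g}(x_0,x_1) \\ {h}(x_0,x_1) \end{bmatrix}.$$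
   Context: Work over $\mathbb{C}$. $\mathrm{Gr}(1,\mathbb{P}^3)\subset\mathbb{P}^5$ is the Grassmannian of lines in $\mathbb{P}^3$. For points $x,y\in\mathbb{P}^3$, $x\vee y$ denotes the line they span, with Plücker coordinates $p_{ij}=x_iy_j-x_jy_i$. A congruence is a surface in $\mathrm{Gr}(1,\mathbb{P}^3)$; it has bidegree $(\alpha,\beta)$ if $\alpha$ of its lines pass through a general point and $\beta$ of its lines lie in a general plane. The forms $f,g,h$ are assumed to be such that the given parametrization is a well-defined morphism (no common zero of $sf,tf,g,h$ on $\mathbb{P}^1$), so that $X$ has degree $\beta$ and meets $L$ in $\beta-1$ points counted with multiplicity (the zeros of $f$). The congruence $C$ is the irreducible surface obtained as the Zariski closure of the set of lines joining a point of $X\setminus L$ with a point of $L\setminus X$; i.e. the congruences of all lines through a fixed point of $X\cap L$ are not included. *)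

theory Defs
  imports "HOL-Analysis.Analysis"
begin

definition proj_rel :: "complex ^ 'n \<Rightarrow> complex ^ 'n \<Rightarrow> bool"
  where "proj_rel u v \<longleftrightarrow> u \<noteq> 0 \<and> v \<noteq> 0 \<and> (\<exists>c. c \<noteq> 0 \<and> u = c *s v)"

text \<open>The projective space of \<open>complex ^ 'n\<close>; thus \<open>4 pspace\<close> is P^3 and \<open>6 pspace\<close> is P^5.
  The numerals 0, 1, 2, 3 are the elements of the index type 4, so \<open>x $ 0\<close>, ..., \<open>x $ 3\<close> are the
  homogeneous coordinates in the usual numbering.\<close>

quotient_type (overloaded) 'n pspace = "complex ^ ('n::finite)" / partial: proj_rel
proof (rule part_equivpI)
  have "proj_rel (1 :: complex ^ 'n) 1"
    unfolding proj_rel_def by (auto simp: vec_eq_iff)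
  then show "\<exists>x :: complex ^ 'n. proj_rel x x" ..
  show "symp (proj_rel :: complex ^ 'n \<Rightarrow> _)"
  proof (rule sympI)
    fix u v :: "complex ^ 'n"
    assume *: "proj_rel u v"
    then obtain c where c: "c \<noteq> 0" "u = c *s v"
      unfolding proj_rel_def by blast
    have "inverse c *s u = v"
      unfolding c(2) vector_smult_assoc using c(1) by simp
    then have "\<exists>c. c \<noteq> 0 \<and> v = c *s u"
      using c(1) by (metis nonzero_imp_inverse_nonzero)
    with * show "proj_rel v u"
      unfolding proj_rel_def by blast
  qed
  show "transp (proj_rel :: complex ^ 'n \<Rightarrow> _)"
  proof (rule transpI)
    fix u v w :: "complex ^ 'n"
    assume *: "proj_rel u v" "proj_rel v w"
    then obtain c d where cd: "c \<noteq> 0" "d \<noteq> 0" "u = c *s v" "v = d *s w"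
      unfolding proj_rel_def by blast
    have "c * d \<noteq> 0" "u = (c * d) *s w"
      using cd(1,2) unfolding cd(3,4) vector_smult_assoc by simp_all
    with * show "proj_rel u w"
      unfolding proj_rel_def by blast
  qed
qed

text \<open>The point with homogeneous coordinates \<open>v\<close>; meaningful only for \<open>v \<noteq> 0\<close>.
  Conversely \<open>rep_pspace\<close> chooses a nonzero coordinate vector of a point; everything below
  that uses it is independent of this choice.\<close>

definition pt :: "complex ^ 'n \<Rightarrow> ('n::finite) pspace"
  where "pt v = abs_pspace v"

text \<open>Homogeneous polynomials of degree \<open>d\<close>, as functions; the zero form has every degree.\<close>

inductive form :: "nat \<Rightarrow> (complex ^ 'n \<Rightarrow> complex) \<Rightarrow> bool" where
  const: "form 0 (\<lambda>x. c)"
| coord: "form 1 (\<lambda>x. x $ i)"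
| add: "form d p \<Longrightarrow> form d q \<Longrightarrow> form d (\<lambda>x. p x + q x)"
| mult: "form d p \<Longrightarrow> form e q \<Longrightarrow> form (d + e) (\<lambda>x. p x * q x)"

definition binary_form :: "nat \<Rightarrow> (complex \<Rightarrow> complex \<Rightarrow> complex) \<Rightarrow> bool"
  where "binary_form d f \<longleftrightarrow> (\<exists>a. \<forall>s t. f s t = (\<Sum>k\<le>d. a k * s ^ k * t ^ (d - k)))"

text \<open>The Zariski topology, given by its base of principal open sets.\<close>

definition zariski :: "('n::finite) pspace topology"
  where "zariski =
    topology_generated_by {{P. F (rep_pspace P) \<noteq> 0} | F. \<exists>d. form d F}"

definition generically :: "(('n::finite) pspace \<Rightarrow> bool) \<Rightarrow> bool"
  where "generically Q \<longleftrightarrow> (\<exists>U. openin zariski U \<and> U \<noteq> {} \<and> (\<forall>P\<in>U. Q P))"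

definition vec4 :: "complex \<Rightarrow> complex \<Rightarrow> complex \<Rightarrow> complex \<Rightarrow> complex ^ 4"
  where "vec4 a b c d =
    (\<chi> i. if i = 0 then a else if i = 1 then b else if i = 2 then c else d)"

text \<open>The Pluecker coordinates in the order 01, 02, 03, 12, 13, 23.\<close>

definition pluecker :: "complex ^ 4 \<Rightarrow> complex ^ 4 \<Rightarrow> complex ^ 6"
  where "pluecker x y = (let p = (\<lambda>i j. x $ i * y $ j - x $ j * y $ i) in
    (\<chi> k. if k = 0 then p 0 1 else if k = 1 then p 0 2 else if k = 2 then p 0 3
          else if k = 3 then p 1 2 else if k = 4 then p 1 3 else p 2 3))"

text \<open>The line spanned by two points, as a point of P^5; meaningful only for \<open>P \<noteq> Q\<close>.\<close>

definition join :: "4 pspace \<Rightarrow> 4 pspace \<Rightarrow> 6 pspace"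
  where "join P Q = pt (pluecker (rep_pspace P) (rep_pspace Q))"

definition Gr :: "6 pspace set"
  where "Gr = {join P Q | P Q. P \<noteq> Q}"

definition points_of :: "6 pspace \<Rightarrow> 4 pspace set"
  where "points_of l = {P. \<exists>Q. Q \<noteq> P \<and> l = join P Q}"

text \<open>A plane in P^3 is given by a point of the dual space, the coefficients of its equation.\<close>

definition plane :: "4 pspace \<Rightarrow> 4 pspace set"
  where "plane H = {P. (\<Sum>i\<in>UNIV. rep_pspace H $ i * rep_pspace P $ i) = 0}"

definition has_bidegree :: "6 pspace set \<Rightarrow> nat \<Rightarrow> nat \<Rightarrow> bool"
  where "has_bidegree C \<alpha> \<beta> \<longleftrightarrow>
    generically (\<lambda>P. finite {l \<in> C. P \<in> points_of l} \<and> card {l \<in> C. P \<in> points_of l} = \<alpha>) \<and>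
    generically (\<lambda>H. finite {l \<in> C. points_of l \<subseteq> plane H} \<and>
                     card {l \<in> C. points_of l \<subseteq> plane H} = \<beta>)"

text \<open>The rational map from P^3 to \<open>C\<close> that sends a generic point to the unique line of \<open>C\<close>
  through it exists and is given by the tuple \<open>F\<close> of forms of a common degree.\<close>

definition rational_camera_given_by :: "6 pspace set \<Rightarrow> (complex ^ 4 \<Rightarrow> complex ^ 6) \<Rightarrow> bool"
  where "rational_camera_given_by C F \<longleftrightarrow>
    (\<exists>d. \<forall>k. form d (\<lambda>x. F x $ k)) \<and>
    generically (\<lambda>P. \<forall>x. x \<noteq> 0 \<and> pt x = P \<longrightarrow>
      F x \<noteq> 0 \<and> {l \<in> C. P \<in> points_of l} = {pt (F x)})"

definition line_L :: "4 pspace set"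
  where "line_L = {pt (vec4 0 0 x2 x3) | x2 x3. (x2, x3) \<noteq> (0, 0)}"

definition curve_X ::
  "(complex \<Rightarrow> complex \<Rightarrow> complex) \<Rightarrow> (complex \<Rightarrow> complex \<Rightarrow> complex) \<Rightarrow>
   (complex \<Rightarrow> complex \<Rightarrow> complex) \<Rightarrow> 4 pspace set"
  where "curve_X f g h =
    {pt (vec4 (s * f s t) (t * f s t) (g s t) (h s t)) | s t. (s, t) \<noteq> (0, 0)}"

text \<open>Since \<open>Gr\<close> is closed in P^5, it does not matter in which of the two the closure is taken.\<close>

definition join_congruence :: "4 pspace set \<Rightarrow> 4 pspace set \<Rightarrow> 6 pspace set"
  where "join_congruence X L =
    subtopology zariski Gr closure_of {join P Q | P Q. P \<in> X - L \<and> Q \<in> L - X}"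

end

theory Submission
  imports Defs "HOL-Computational_Algebra.Fundamental_Theorem_Algebra"
begin

text \<open>A line of \<open>C\<close> meets \<open>L\<close>, so its Pluecker vector is \<open>(0, s a, s b, t a, t b, r)\<close>, where \<open>(0 : 0 : a : b)\<close>
  is its point on \<open>L\<close> and \<open>(s : t)\<close> is the plane through \<open>L\<close> that contains it. That plane meets the curve
  outside \<open>L\<close> in the point with parameter \<open>(s : t)\<close> only, and the line passes through it iff
  \<open>r f(s, t) = b g(s, t) - a h(s, t)\<close>. This equation is closed, so it holds on \<open>C\<close>; conversely it puts
  the line into \<open>C\<close> if \<open>f(s, t) \<noteq> 0\<close> and \<open>(0 : 0 : a : b)\<close> is not on \<open>X\<close>. For the lines through a general
  point \<open>x\<close> it determines \<open>(a : b)\<close>, which gives the camera. For the lines in a general plane \<open>u\<close>,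
  the point \<open>(a : b) = (u_3 : -u_2)\<close> is fixed and the equation becomes the binary form of degree \<open>\<beta>\<close> that cuts out the intersection of the
  plane with \<open>X\<close>. It has \<open>\<beta>\<close> distinct zeros for general \<open>u\<close>, by a Bertini argument: the linear system
  is base point free, so some member is squarefree (look at a pencil and its Wronskian), and
  squarefreeness is an open condition.\<close>

subsection \<open>Forms and points of projective space\<close>

lemma form_scale: "form d p \<Longrightarrow> p (c *s x) = c ^ d * p x"
  by (induction arbitrary: rule: form.induct) (simp_all add: algebra_simps power_add)

lemma form_cmult: "form d p \<Longrightarrow> form d (\<lambda>x. c * p x)"
  using form.mult[OF form.const, of d p c] by simp

lemma form_cong_degree: "form d p \<Longrightarrow> d = e \<Longrightarrow> form e p"
  by simp

lemma form_minus: "form d p \<Longrightarrow> form d q \<Longrightarrow> form d (\<lambda>x. p x - q x)"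
  using form.add[OF _ form_cmult, of d p q "-1"] by simp

lemma form_power: "form d p \<Longrightarrow> form (d * n) (\<lambda>x. p x ^ n)"
proof (induction n)
  case (Suc n)
  then show ?case using form.mult[of d p "d * n" "\<lambda>x. p x ^ n"] by simp
qed (simp add: form.const)

text \<open>Constants are introduced in degree 0 only, so the zero form of degree \<open>d\<close>
  arises as 0 times the \<open>d\<close>-th power of a coordinate.\<close>

lemma form_zero: "form d (\<lambda>x :: complex ^ 'n. 0)"
proof -
  have "form (1 * d) (\<lambda>x :: complex ^ 'n. (x $ undefined) ^ d)"
    by (intro form_power form.coord)
  from form_cmult[OF this, of 0] show ?thesis by simp
qed

lemma form_sum: "(\<And>a. a \<in> A \<Longrightarrow> form d (p a)) \<Longrightarrow> form d (\<lambda>x. \<Sum>a\<in>A. p a x)"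
  by (induction A rule: infinite_finite_induct) (auto intro: form_zero form.add)

lemma form_linear: "form 1 (\<lambda>x :: complex ^ 'n::finite. \<Sum>i\<in>UNIV. x $ i * c i)"
  using form_sum[of UNIV 1 "\<lambda>i (x :: complex ^ 'n). c i * x $ i"]
  by (simp add: form_cmult form.coord[simplified] mult.commute)

lemma form_on_line: "form d p \<Longrightarrow> \<exists>P. \<forall>c. p (x + c *s v) = poly P c"
proof (induction rule: form.induct)
  case (const c)
  show ?case by (rule exI[of _ "[:c:]"]) simp
next
  case (coord i)
  show ?case by (rule exI[of _ "[:x $ i, v $ i:]"]) simp
next
  case (add d p q)
  then show ?case by (metis poly_add)
next
  case (mult d p e q)
  then show ?case by (metis poly_mult)
qed

text \<open>Irreducibility of affine space: on the line through \<open>x\<close> and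
  \<open>y\<close> both forms become nonzero polynomials in one variable, and so does their product.
  This is what allows open conditions to be combined.\<close>

lemma form_mult_nonzero:
  assumes "form d p" "form e q" "p x \<noteq> 0" "q y \<noteq> 0"
  shows "\<exists>z. p z * q z \<noteq> 0"
proof -
  obtain P Q where P: "\<And>c. p (x + c *s (y - x)) = poly P c"
    and Q: "\<And>c. q (x + c *s (y - x)) = poly Q c"
    using form_on_line assms(1,2) by metis
  have "poly P 0 \<noteq> 0" "poly Q 1 \<noteq> 0"
    using assms(3,4) P[of 0] Q[of 1] by simp_all
  then have "P * Q \<noteq> 0" by auto
  then obtain c where "poly (P * Q) c \<noteq> 0"
    using poly_all_0_iff_0 by blast
  then show ?thesis using P Q by (intro exI[of _ "x + c *s (y - x)"]) simp
qed

lemma form_prod_nonzero: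
  assumes "finite A" "\<And>a. a \<in> A \<Longrightarrow> form (d a) (p a)" "\<And>a. a \<in> A \<Longrightarrow> \<exists>x. p a x \<noteq> 0"
  shows "form (\<Sum>a\<in>A. d a) (\<lambda>x. \<Prod>a\<in>A. p a x) \<and> (\<exists>x. (\<Prod>a\<in>A. p a x) \<noteq> 0)"
  using assms
proof (induction A rule: finite_induct)
  case empty
  show ?case by (simp add: form.const)
next
  case (insert a A)
  then have *: "form (d a) (p a)" "\<exists>x. p a x \<noteq> 0"
    "form (\<Sum>a\<in>A. d a) (\<lambda>x. \<Prod>a\<in>A. p a x)" "\<exists>x. (\<Prod>a\<in>A. p a x) \<noteq> 0"
    by auto
  then show ?case
    using form.mult[OF *(1,3)] form_mult_nonzero[OF *(1,3)] insert.hyps by auto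
qed

lemma binary_form_form:
  assumes "binary_form d f" "form 1 p" "form 1 q"
  shows "form d (\<lambda>x. f (p x) (q x))"
proof -
  obtain a where a: "\<And>s t. f s t = (\<Sum>k\<le>d. a k * s ^ k * t ^ (d - k))"
    using assms(1) unfolding binary_form_def by blast
  have "form d (\<lambda>x. a k * p x ^ k * q x ^ (d - k))" if "k \<le> d" for k
    using form.mult[OF form_cmult[OF form_power[OF assms(2), of k], of "a k"]
        form_power[OF assms(3), of "d - k"]] that
    by simp
  then show ?thesis unfolding a by (intro form_sum) auto
qed

lemma binary_form_scale: "binary_form d f \<Longrightarrow> f (c * s) (c * t) = c ^ d * f s t"
  unfolding binary_form_def
  by (auto simp: sum_distrib_left power_mult_distrib power_add[symmetric] mult_ac intro!: sum.cong)

text \<open>Dehomogenization at \<open>t = 1\<close>; the coefficient in degree \<open>d\<close>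
  keeps the value at the point at infinity \<open>(1 : 0)\<close>.\<close>

lemma binary_form_poly:
  assumes "binary_form d f"
  obtains F where "degree F \<le> d" "\<And>z. poly F z = f z 1" "coeff F d = f 1 0"
proof -
  obtain a where a: "\<And>s t. f s t = (\<Sum>k\<le>d. a k * s ^ k * t ^ (d - k))"
    using assms unfolding binary_form_def by blast
  define F where "F = (\<Sum>k\<le>d. monom (a k) k)"
  have "degree F \<le> d"
    unfolding F_def by (rule degree_sum_le) (auto intro: order_trans[OF degree_monom_le])
  moreover have "poly F z = f z 1" for z
    by (simp add: F_def a poly_sum poly_monom)
  moreover have "coeff F d = f 1 0"
  proof -
    have "f 1 0 = (\<Sum>k\<le>d. if k = d then a k else 0)"
      unfolding a by (intro sum.cong) auto
    then show ?thesis by (simp add: F_def coeff_sum)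
  qed
  ultimately show ?thesis by (rule that)
qed

section \<open>Homogeneous coordinates, genericity and closure\<close>

lemma proj_rel_iff_pt: "proj_rel u v \<longleftrightarrow> u \<noteq> 0 \<and> v \<noteq> 0 \<and> pt u = pt v"
proof -
  have "u \<noteq> 0 \<Longrightarrow> proj_rel u u" for u :: "complex ^ 'n::finite"
    unfolding proj_rel_def by (auto intro!: exI[of _ 1])
  then show ?thesis
    using Quotient3_rel[OF Quotient3_pspace, of u v] unfolding pt_def by (auto simp: proj_rel_def)
qed

lemma pt_eqD: "pt u = pt v \<Longrightarrow> u \<noteq> 0 \<Longrightarrow> v \<noteq> 0 \<Longrightarrow> \<exists>c. c \<noteq> 0 \<and> u = c *s v"
  using proj_rel_iff_pt[of u v] unfolding proj_rel_def by blast

lemma pt_scale: "c \<noteq> 0 \<Longrightarrow> pt (c *s v) = pt v"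
  using proj_rel_iff_pt[of "c *s v" v] unfolding proj_rel_def
  by (cases "v = 0") auto

lemma rep_pspace_nonzero: "rep_pspace P \<noteq> 0"
  using Quotient3_rep_reflp[OF Quotient3_pspace, of P] unfolding proj_rel_def by blast

lemma pt_rep: "pt (rep_pspace P) = P"
  unfolding pt_def by (rule Quotient3_abs_rep[OF Quotient3_pspace])

lemma pspace_cases: obtains x where "x \<noteq> 0" "P = pt x"
  using rep_pspace_nonzero pt_rep by metis

lemma rep_ptE:
  assumes "x \<noteq> 0"
  obtains c where "c \<noteq> 0" "rep_pspace (pt x) = c *s x"
  using pt_eqD[OF pt_rep rep_pspace_nonzero assms] by blast

lemma form_rep_pt: "form d F \<Longrightarrow> x \<noteq> 0 \<Longrightarrow> F (rep_pspace (pt x)) = 0 \<longleftrightarrow> F x = 0"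
  by (rule rep_ptE[of x]) (auto simp: form_scale)

text \<open>The locus where \<open>F\<close> does not vanish is the required open set, and
  \<open>x\<close> shows that it is nonempty. Every genericity claim below is proved by exhibiting
  one such form.\<close>

lemma generically_form:
  assumes "form d F" "x \<noteq> 0" "F x \<noteq> 0" and Q: "\<And>x. x \<noteq> 0 \<Longrightarrow> F x \<noteq> 0 \<Longrightarrow> Q (pt x)"
  shows "generically Q"
  unfolding generically_def
proof (intro exI conjI ballI)
  let ?U = "{P. F (rep_pspace P) \<noteq> 0}"
  show "openin zariski ?U"
    unfolding zariski_def by (rule topology_generated_by_Basis) (use assms(1) in auto)
  show "?U \<noteq> {}"
    using form_rep_pt[OF assms(1,2)] assms(3) by blast
  show "Q P" if "P \<in> ?U" for P
    using Q[OF rep_pspace_nonzero, of P] that by (simp add: pt_rep)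
qed

text \<open>The zero locus of a form is closed, so an equation valid on \<open>S\<close> persists on
  its closure.\<close>

lemma form_closure_of:
  assumes "l \<in> subtopology zariski G closure_of S" "form d F"
    and "\<And>l. l \<in> S \<Longrightarrow> F (rep_pspace l) = 0"
  shows "F (rep_pspace l) = 0"
proof (rule ccontr)
  let ?U = "{P. F (rep_pspace P) \<noteq> 0}"
  assume "F (rep_pspace l) \<noteq> 0"
  moreover have "openin zariski ?U"
    unfolding zariski_def by (rule topology_generated_by_Basis) (use assms(2) in auto)
  then have "openin (subtopology zariski G) (?U \<inter> G)"
    by (auto simp: openin_subtopology)
  moreover have "l \<in> G"
    using assms(1) by (simp add: in_closure_of)
  ultimately obtain y where "y \<in> S" "y \<in> ?U \<inter> G"
    using assms(1) unfolding in_closure_of by (metis (mono_tags, lifting) IntI mem_Collect_eq)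
  then show False using assms(3)[of y] by simp
qed

lemma topspace_zariski: "topspace (zariski :: ('n::finite) pspace topology) = UNIV"
proof -
  have "UNIV \<in> {{P :: 'n pspace. F (rep_pspace P) \<noteq> 0} | F. \<exists>d. form d F}"
    using form.const[of 1] by (auto intro!: exI[of _ "\<lambda>x. 1"])
  then show ?thesis
    unfolding zariski_def topology_generated_by_topspace by blast
qed

subsection \<open>General members of a linear system on the affine line\<close>

text \<open>Stands in for the determinant: \<open>R\<close> is the product of the pivots of a
  Gaussian elimination whose pivots are nonzero at \<open>u0\<close>. The degree of the entries
  doubles in each round, hence the arbitrary \<open>d\<close>.\<close>

lemma form_trivial_kernel_open:
  fixes A :: "nat \<Rightarrow> nat \<Rightarrow> complex ^ 'n \<Rightarrow> complex"
  assumes "\<And>i j. i < N \<Longrightarrow> j < N \<Longrightarrow> form d (A i j)"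
    and "\<forall>x. (\<forall>i<N. (\<Sum>j<N. A i j u0 * x j) = 0) \<longrightarrow> (\<forall>j<N. x j = 0)"
  shows "\<exists>e R. form e R \<and> R u0 \<noteq> 0 \<and>
    (\<forall>u x j. R u \<noteq> 0 \<longrightarrow> (\<forall>i<N. (\<Sum>j<N. A i j u * x j) = 0) \<longrightarrow> j < N \<longrightarrow> x j = 0)"
  using assms
proof (induction N arbitrary: d A)
  case 0
  show ?case by (intro exI[of _ 0] exI[of _ "\<lambda>_. 1"]) (auto intro: form.const)
next
  case (Suc N)
  obtain k where k: "k < Suc N" "A k N u0 \<noteq> 0"
  proof (rule ccontr)
    assume "\<not> thesis"
    then have "\<And>i. i < Suc N \<Longrightarrow> A i N u0 = 0" using that by blast
    \<comment> \<open>If the last column vanished at \<open>u0\<close>, the last unit vector would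
      lie in the kernel.\<close>
    then have "(1 :: complex) = 0"
      using Suc.prems(2)[rule_format, of "\<lambda>j. if j = N then 1 else 0" N] by simp
    then show False by simp
  qed
  \<comment> \<open>Fraction-free elimination of the last unknown with pivot row \<open>k\<close>; the pivot becomes a factor
    of the new form \<open>R\<close>.\<close>
  define A' where "A' i = A (if i = k then N else i)" for i
  \<comment> \<open>\<open>A'\<close> moves the last row into slot \<open>k\<close>, so its first
    \<open>N\<close> rows are the rows of \<open>A\<close> other than row \<open>k\<close>.\<close>
  have rows: "(\<forall>i<Suc N. P (A i)) \<longleftrightarrow> P (A k) \<and> (\<forall>i<N. P (A' i))" for P
    using k(1) unfolding A'_def by (auto simp: less_Suc_eq)
  have form_A': "form d (A' i j)" if "i < N" "j < Suc N" for i j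
    using Suc.prems(1) that unfolding A'_def by auto
  define B where "B i j u = A k N u * A' i j u - A' i N u * A k j u" for i j u
  have B_sum: "(\<Sum>j<N. B i j u * x j) =
      A k N u * (\<Sum>j<N. A' i j u * x j) - A' i N u * (\<Sum>j<N. A k j u * x j)" for i u x
    by (simp add: B_def sum_distrib_left sum_subtractf algebra_simps)
  have form_B: "form (d + d) (B i j)" if "i < N" "j < N" for i j
    unfolding B_def using Suc.prems(1) form_A' k(1) that
    by (intro form_minus form.mult) auto
  have "y j = 0" if y: "\<And>i. i < N \<Longrightarrow> (\<Sum>j<N. B i j u0 * y j) = 0" and j: "j < N" for y j
  proof -
    \<comment> \<open>Back substitution: a kernel vector of \<open>B\<close> at \<open>u0\<close>,
      multiplied by the pivot to avoid division, extends to a kernel vector of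
      \<open>A\<close>.\<close>
    define x where "x j = (if j < N then y j * A k N u0 else - (\<Sum>j<N. A k j u0 * y j))" for j
    have x_sum: "(\<Sum>j<Suc N. a j * x j) =
        A k N u0 * (\<Sum>j<N. a j * y j) - a N * (\<Sum>j<N. A k j u0 * y j)" for a
      by (simp add: x_def sum_distrib_left mult_ac)
    have "\<forall>i<Suc N. (\<Sum>j<Suc N. A i j u0 * x j) = 0"
    proof (rule rows[of "\<lambda>a. (\<Sum>j<Suc N. a j u0 * x j) = 0", THEN iffD2], intro conjI allI impI)
      show "(\<Sum>j<Suc N. A k j u0 * x j) = 0"
        using x_sum[of "\<lambda>j. A k j u0"] by simp
      show "(\<Sum>j<Suc N. A' i j u0 * x j) = 0" if "i < N" for i
        using x_sum[of "\<lambda>j. A' i j u0"] y[OF that] B_sum[of i u0 y] by simp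
    qed
    then have "x j = 0" using Suc.prems(2)[rule_format, of x j] j by simp
    then show ?thesis using j k(2) by (simp add: x_def)
  qed
  then have triv: "\<forall>x. (\<forall>i<N. (\<Sum>j<N. B i j u0 * x j) = 0) \<longrightarrow> (\<forall>j<N. x j = 0)"
    by blast
  from Suc.IH[OF form_B triv] obtain e R where R: "form e R" "R u0 \<noteq> 0"
    "\<And>u x j. R u \<noteq> 0 \<Longrightarrow> (\<forall>i<N. (\<Sum>j<N. B i j u * x j) = 0) \<Longrightarrow> j < N \<Longrightarrow> x j = 0"
    by blast
  show ?case
  proof (intro exI conjI allI impI)
    show "form (d + e) (\<lambda>u. A k N u * R u)"
      using Suc.prems(1) k(1) R(1) by (intro form.mult) auto
    show "A k N u0 * R u0 \<noteq> 0" using k R by simp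
    fix u x j
    assume nz: "A k N u * R u \<noteq> 0" and x: "\<forall>i<Suc N. (\<Sum>j<Suc N. A i j u * x j) = 0"
      and j: "j < Suc N"
    from x[unfolded rows[of "\<lambda>a. (\<Sum>j<Suc N. a j u * x j) = 0"]]
    have xk: "(\<Sum>j<N. A k j u * x j) = - A k N u * x N"
      and xi: "\<And>i. i < N \<Longrightarrow> (\<Sum>j<N. A' i j u * x j) = - A' i N u * x N"
      by (auto simp: add_eq_0_iff)
    have *: "x j = 0" if "j < N" for j
      by (rule R(3)[of u]) (use nz that in \<open>auto simp: B_sum xk xi\<close>)
    then have "A k N u * x N = 0" using xk by simp
    then show "x j = 0" using * j nz by (cases "j = N") auto
  qed
qed

text \<open>Induction on the degree: a root exists over the complex numbers, and being simple it is
  not a root of the cofactor.\<close>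

lemma card_simple_roots:
  fixes p :: "complex poly"
  assumes "p \<noteq> 0" "\<And>z. poly p z = 0 \<Longrightarrow> poly (pderiv p) z \<noteq> 0"
  shows "card {z. poly p z = 0} = degree p"
  using assms
proof (induction "degree p" arbitrary: p)
  case 0
  then obtain c where "p = [:c:]" using degree_eq_zeroE by metis
  then show ?case using 0 by simp
next
  case (Suc d)
  then have "\<not> constant (poly p)" by (simp add: constant_degree)
  then obtain z where z: "poly p z = 0" using fundamental_theorem_of_algebra by blast
  then obtain q where q: "p = [:-z, 1:] * q" unfolding poly_eq_0_iff_dvd by blast
  have dp: "pderiv p = [:-z, 1:] * pderiv q + q"
    unfolding q by (simp only: pderiv_mult) (simp add: pderiv_pCons algebra_simps)
  have "q \<noteq> 0" using Suc.prems(1) q by auto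
  have "degree p = Suc (degree q)" unfolding q using \<open>q \<noteq> 0\<close> by (subst degree_mult_eq) auto
  have "card {z. poly q z = 0} = degree q"
  proof (rule Suc.hyps)
    show "d = degree q" using \<open>degree p = Suc (degree q)\<close> Suc.hyps by simp
    show "q \<noteq> 0" by fact
    show "poly (pderiv q) y \<noteq> 0" if "poly q y = 0" for y
      using Suc.prems(2)[rule_format, of y] that unfolding dp by (auto simp: q)
  qed
  moreover have "{y. poly p y = 0} = insert z {y. poly q y = 0}"
    unfolding q by auto
  moreover have "poly q z \<noteq> 0" using Suc.prems(2)[OF z] unfolding dp by simp
  ultimately show ?case
    using \<open>degree p = Suc (degree q)\<close> poly_roots_finite[OF \<open>q \<noteq> 0\<close>] by simp
qed

text \<open>A multiple root amounts to a nontrivial kernel of a square system whose entries are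
  linear in \<open>u\<close>, so \<open>form_trivial_kernel_open\<close> applies. For
  \<open>m = 0\<close> the constant coefficient serves as \<open>R\<close>.\<close>

lemma simple_roots_open:
  fixes p :: "complex ^ 'n \<Rightarrow> complex poly"
  assumes form: "\<And>k. form 1 (\<lambda>u. coeff (p u) k)"
    and deg: "degree (p u0) = m" "\<And>u. degree (p u) \<le> m"
    and simple: "\<And>z. poly (p u0) z = 0 \<Longrightarrow> poly (pderiv (p u0)) z \<noteq> 0"
  shows "\<exists>e R. form e R \<and> R u0 \<noteq> 0 \<and>
    (\<forall>u z. R u \<noteq> 0 \<longrightarrow> degree (p u) = m \<longrightarrow> poly (p u) z = 0 \<longrightarrow> poly (pderiv (p u)) z \<noteq> 0)"
proof (cases m)
  case 0
  show ?thesis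
  proof (intro exI[of _ 1] exI[of _ "\<lambda>u. coeff (p u) 0"] conjI allI impI)
    have "p u0 \<noteq> 0"
    proof
      assume "p u0 = 0"
      then show False using simple by auto
    qed
    then show "coeff (p u0) 0 \<noteq> 0" using deg(1) 0 leading_coeff_0_iff by metis
    fix u z assume "coeff (p u) 0 \<noteq> 0" "degree (p u) = m" "poly (p u) z = 0"
    then show "poly (pderiv (p u)) z \<noteq> 0" using 0 by (auto elim!: degree_eq_zeroE)
  qed (rule form)
next
  case (Suc n)
  \<comment> \<open>\<open>p\<close> has a multiple root iff \<open>r * p = s * pderiv p\<close> for some \<open>(r, s) \<noteq> 0\<close> with \<open>degree r < n\<close> and
    \<open>degree s < m\<close>; \<open>A\<close> is the matrix of this linear system (a Sylvester matrix), and the unknown \<open>x\<close>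
    lists the coefficients of \<open>r\<close>, then those of \<open>s\<close>.\<close>
  define A where "A i j u = (if j < n then coeff (monom 1 j * p u) i
    else - coeff (monom 1 (j - n) * pderiv (p u)) i)" for i j u
  define r where "r x = (\<Sum>j<n. monom (x j) j)" for x :: "nat \<Rightarrow> complex"
  define s where "s x = (\<Sum>j<m. monom (x (n + j)) j)" for x :: "nat \<Rightarrow> complex"
  have split: "{..<n + m} = {..<n} \<union> {n..<n + m}" by auto
  have A_sum: "(\<Sum>j<n + m. A i j u * x j) = coeff (r x * p u - s x * pderiv (p u)) i" for i u x
  proof -
    have "(\<Sum>j<n + m. A i j u * x j) = (\<Sum>j<n. A i j u * x j) + (\<Sum>j=n..<n + m. A i j u * x j)"
      unfolding split by (rule sum.union_disjoint) auto
    also have "(\<Sum>j=n..<n + m. A i j u * x j) = (\<Sum>j<m. A i (n + j) u * x (n + j))"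
      using sum.shift_bounds_nat_ivl[of "\<lambda>j. A i j u * x j" 0 n m]
      by (simp add: add.commute lessThan_atLeast0)
    also have "(\<Sum>j<n. A i j u * x j) = coeff (r x * p u) i"
      unfolding r_def sum_distrib_right coeff_sum
      by (intro sum.cong) (simp_all add: A_def coeff_monom_mult)
    also have "(\<Sum>j<m. A i (n + j) u * x (n + j)) = - coeff (s x * pderiv (p u)) i"
      unfolding s_def sum_distrib_right coeff_sum sum_negf[symmetric]
      by (intro sum.cong) (simp_all add: A_def coeff_monom_mult)
    finally show ?thesis by simp
  qed
  have form_A: "form 1 (A i j)" for i j
  proof -
    have "form 1 (\<lambda>u. coeff (monom 1 a * p u) i)" for a
      unfolding coeff_monom_mult using form[simplified] by (cases "a \<le> i") (simp_all add: form_zero)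
    moreover have "form 1 (\<lambda>u. - coeff (monom 1 a * pderiv (p u)) i)" for a
      using form_cmult[OF form_cmult[OF form], of "-1" "of_nat (Suc (i - a))" "Suc (i - a)"]
      by (cases "a \<le> i") (simp_all add: coeff_monom_mult coeff_pderiv form_zero)
    ultimately show ?thesis unfolding A_def by (cases "j < n") auto
  qed
  have "x j = 0" if x: "\<And>i. i < n + m \<Longrightarrow> (\<Sum>j<n + m. A i j u0 * x j) = 0" and j: "j < n + m" for x j
  proof -
    have deg_r: "degree (r x) < n \<or> r x = 0" and deg_s: "degree (s x) < m"
    proof -
      have "n \<noteq> 0 \<Longrightarrow> degree (r x) \<le> n - 1"
        unfolding r_def by (rule degree_sum_le) (auto intro: order_trans[OF degree_monom_le])
      then show "degree (r x) < n \<or> r x = 0" by (cases n) (auto simp: r_def)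
      have "degree (s x) \<le> m - 1"
        unfolding s_def by (rule degree_sum_le) (auto intro: order_trans[OF degree_monom_le])
      then show "degree (s x) < m" using Suc by simp
    qed
    have "p u0 \<noteq> 0" using deg(1) Suc by auto
    have eq: "r x * p u0 = s x * pderiv (p u0)"
    proof (rule poly_eqI)
      fix i
      show "coeff (r x * p u0) i = coeff (s x * pderiv (p u0)) i"
      proof (cases "i < n + m")
        case True
        then show ?thesis using x[OF True] unfolding A_sum by simp
      next
        case False
        have "degree (s x * pderiv (p u0)) \<le> degree (s x) + degree (pderiv (p u0))"
          by (rule degree_mult_le)
        also have "\<dots> < i" using False deg_s deg(1) Suc by (simp add: degree_pderiv)
        finally have "coeff (s x * pderiv (p u0)) i = 0" by (rule coeff_eq_0)
        moreover have "coeff (r x * p u0) i = 0"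
        proof (cases "r x = 0")
          case False
          have "degree (r x * p u0) \<le> degree (r x) + degree (p u0)"
            by (rule degree_mult_le)
          also have "\<dots> < i" using False \<open>\<not> i < n + m\<close> deg_r deg(1) by simp
          finally show ?thesis by (rule coeff_eq_0)
        qed simp
        ultimately show ?thesis by simp
      qed
    qed
    \<comment> \<open>At a root of \<open>p u0\<close> the derivative does not vanish, so
      \<open>s x\<close> does. These are \<open>m\<close> distinct roots, too many for a nonzero
      polynomial of degree below \<open>m\<close>.\<close>
    have "s x = 0"
    proof (rule ccontr)
      assume nz: "s x \<noteq> 0"
      have "poly (s x) z = 0" if "poly (p u0) z = 0" for z
        using arg_cong[OF eq, of "\<lambda>p. poly p z"] that simple[OF that] by simp
      then have "card {z. poly (p u0) z = 0} \<le> card {z. poly (s x) z = 0}"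
        by (intro card_mono poly_roots_finite nz) auto
      also have "\<dots> \<le> degree (s x)" by (rule card_poly_roots_bound[OF nz])
      finally show False
        using card_simple_roots[OF \<open>p u0 \<noteq> 0\<close> simple] deg(1) deg_s by simp
    qed
    moreover from this have "r x = 0" using eq \<open>p u0 \<noteq> 0\<close> by simp
    moreover have "coeff (r x) j = x j" if "j < n"
      using that by (simp add: r_def coeff_sum)
    moreover have "coeff (s x) (j - n) = x j" if "\<not> j < n"
      using that j by (simp add: s_def coeff_sum)
    ultimately show ?thesis by fastforce
  qed
  then have triv: "\<forall>x. (\<forall>i<n + m. (\<Sum>j<n + m. A i j u0 * x j) = 0) \<longrightarrow> (\<forall>j<n + m. x j = 0)"
    by blast
  from form_trivial_kernel_open[OF form_A triv] obtain e R where
    R: "form e R" "R u0 \<noteq> 0"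
    "\<And>u x j. R u \<noteq> 0 \<Longrightarrow> (\<forall>i<n + m. (\<Sum>j<n + m. A i j u * x j) = 0) \<Longrightarrow> j < n + m \<Longrightarrow> x j = 0"
    by blast
  show ?thesis
  proof (intro exI conjI allI impI)
    show "form e R" "R u0 \<noteq> 0" by fact+
    fix u z assume u: "R u \<noteq> 0" "degree (p u) = m" "poly (p u) z = 0"
    show "poly (pderiv (p u)) z \<noteq> 0"
    proof
      assume "poly (pderiv (p u)) z = 0"
      obtain q where q: "p u = [:-z, 1:] * q" using u(3) unfolding poly_eq_0_iff_dvd by blast
      have dp: "pderiv (p u) = [:-z, 1:] * pderiv q + q"
        unfolding q by (simp only: pderiv_mult) (simp add: pderiv_pCons algebra_simps)
      obtain t where t: "pderiv (p u) = [:-z, 1:] * t"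
        using \<open>poly (pderiv (p u)) z = 0\<close> unfolding poly_eq_0_iff_dvd by blast
      have "q \<noteq> 0" using u(2) q Suc by auto
      have "degree (p u) = Suc (degree q)" unfolding q using \<open>q \<noteq> 0\<close> by (subst degree_mult_eq) auto
      then have dq: "degree q = n" using u(2) Suc by simp
      have "degree (pderiv (p u)) = n" using u(2) Suc by (simp add: degree_pderiv)
      have "t = 0 \<or> degree t < n"
      proof (cases "t = 0")
        case False
        then have "degree (pderiv (p u)) = Suc (degree t)" unfolding t by (subst degree_mult_eq) auto
        then show ?thesis using \<open>degree (pderiv (p u)) = n\<close> by simp
      qed simp
      \<comment> \<open>A multiple root \<open>z\<close> can be divided out of both
        \<open>p u\<close> and its derivative; the quotients \<open>q\<close> and \<open>t\<close>
        satisfy \<open>t * p u = q * pderiv (p u)\<close> and yield a kernel vector.\<close>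
      define x where "x j = (if j < n then coeff t j else coeff q (j - n))" for j
      have "r x = t"
        by (rule poly_eqI) (use \<open>t = 0 \<or> degree t < n\<close> in
          \<open>auto simp: r_def x_def coeff_sum if_distrib[of "\<lambda>x. x = _"] coeff_eq_0\<close>)
      moreover have "s x = q"
        by (rule poly_eqI) (use dq Suc in \<open>auto simp: s_def x_def coeff_sum coeff_eq_0\<close>)
      moreover have "t * p u = q * pderiv (p u)" by (subst t, subst q) (simp only: mult_ac)
      ultimately have "\<forall>i<n + m. (\<Sum>j<n + m. A i j u * x j) = 0"
        unfolding A_sum by simp
      \<comment> \<open>The coefficients of \<open>q\<close> start at index \<open>n\<close>, so
        index \<open>n + n\<close> holds the leading one.\<close>
      then have "x (n + n) = 0" using R(3)[OF u(1), of x "n + n"] Suc by simp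
      then show False using \<open>q \<noteq> 0\<close> dq leading_coeff_0_iff[of q] by (simp add: x_def)
    qed
  qed
qed


text \<open>A nonzero coefficient in degree \<open>m\<close> means that there is no root at
  infinity, so all \<open>m\<close> roots are visible in the affine chart. One good member
  \<open>u0\<close> suffices, by \<open>simple_roots_open\<close>.\<close>

lemma linear_system_generic_simple:
  fixes b :: "'n::finite \<Rightarrow> complex poly"
  defines "p \<equiv> \<lambda>u :: complex ^ 'n. \<Sum>i\<in>UNIV. smult (u $ i) (b i)"
  assumes deg: "\<And>i. degree (b i) \<le> m" and top: "coeff (b i0) m \<noteq> 0" and "m \<ge> 1"
    and base: "\<And>z. \<exists>i. poly (b i) z \<noteq> 0"
  shows "\<exists>e R. form e R \<and> (\<exists>u. R u \<noteq> 0) \<and>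
    (\<forall>u. R u \<noteq> 0 \<longrightarrow> coeff (p u) m \<noteq> 0 \<and> card {z. poly (p u) z = 0} = m)"
proof -
  have form_coeff: "form 1 (\<lambda>u. coeff (p u) k)" for k
    unfolding p_def coeff_sum coeff_smult by (rule form_linear)
  have form_poly: "form 1 (\<lambda>u. poly (p u) z)" for z
    unfolding p_def poly_sum poly_smult by (rule form_linear)
  have deg_p: "degree (p u) \<le> m" for u
    unfolding p_def by (rule degree_sum_le) (auto simp: deg)
  have p_axis: "p (axis i 1) = b i" for i
    unfolding p_def by (subst sum.remove[of _ i]) (auto simp: axis_def intro!: sum.neutral)
  have p_lin: "p (u - c *s v) = p u - smult c (p v)" for u v c
    unfolding p_def by (simp add: sum_subtractf smult_diff_left) (simp add: poly_eq_iff coeff_sum sum_distrib_left mult.assoc)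
  have degree_eq: "degree (p u) = m" if "coeff (p u) m \<noteq> 0" for u
    using le_degree[OF that] deg_p[of u] by simp
  obtain u1 where u1: "coeff (p u1) m \<noteq> 0" using top p_axis by metis
  define w1 where "w1 = p u1"
  have w1: "degree w1 = m" "w1 \<noteq> 0" using degree_eq[OF u1] u1 unfolding w1_def by auto
  have "\<exists>u. poly (p u) z \<noteq> 0" for z using base p_axis by metis
  \<comment> \<open>For each of the finitely many roots \<open>z\<close> of \<open>w1\<close>, the
    value at \<open>z\<close> is a nonzero linear form in \<open>u\<close>; the product of these
    forms is nonzero somewhere.\<close>
  then have "\<exists>u. (\<Prod>z\<in>{z. poly w1 z = 0}. poly (p u) z) \<noteq> 0"
    using form_prod_nonzero[OF poly_roots_finite[OF w1(2)], of "\<lambda>_. 1" "\<lambda>z u. poly (p u) z"] form_poly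
    by blast
  then obtain u2 where u2: "(\<Prod>z\<in>{z. poly w1 z = 0}. poly (p u2) z) \<noteq> 0" by blast
  define w2 where "w2 = p u2"
  have no_common: "poly w2 z \<noteq> 0" if "poly w1 z = 0" for z
    using u2 poly_roots_finite[OF w1(2)] that unfolding w2_def by auto
  define W where "W = pderiv w1 * w2 - w1 * pderiv w2"
  \<comment> \<open>If the Wronskian vanished, then at a root of \<open>w1\<close>, where
    \<open>w2\<close> is nonzero, \<open>pderiv w1\<close> would have at least the order of
    \<open>w1\<close>; but its order is one less.\<close>
  have "W \<noteq> 0"
  proof
    assume "W = 0"
    then have eq: "pderiv w1 * w2 = w1 * pderiv w2" unfolding W_def by simp
    have "\<not> constant (poly w1)" using w1(1) \<open>m \<ge> 1\<close> by (simp add: constant_degree)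
    then obtain z where z: "poly w1 z = 0" using fundamental_theorem_of_algebra by blast
    have nz: "pderiv w1 \<noteq> 0" "w2 \<noteq> 0"
      using w1(1) \<open>m \<ge> 1\<close> no_common[OF z] by (auto simp: pderiv_eq_0_iff)
    then have nz': "pderiv w1 * w2 \<noteq> 0" "w1 * pderiv w2 \<noteq> 0" using eq by auto
    have "order z w2 = 0" using no_common[OF z] by (simp add: order_root)
    then have "order z (pderiv w1) = order z w1 + order z (pderiv w2)"
      using arg_cong[OF eq, of "order z"] unfolding order_mult[OF nz'(1)] order_mult[OF nz'(2)]
      by simp
    moreover have "order z w1 = Suc (order z (pderiv w1))"
      using z w1(2) nz(1) by (intro order_pderiv) (auto simp: order_root)
    ultimately show False by simp
  qed
  \<comment> \<open>A double root of \<open>w1 - c w2\<close> is a zero of the Wronskian, and \<open>c\<close> is then the value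
    of \<open>w1 / w2\<close> there; so only finitely many \<open>c\<close> are bad.\<close>
  define bad where "bad = insert (coeff w1 m / coeff w2 m) ((\<lambda>z. poly w1 z / poly w2 z) ` {z. poly W z = 0})"
  have "finite bad" unfolding bad_def by (simp add: poly_roots_finite[OF \<open>W \<noteq> 0\<close>])
  then obtain c where c: "c \<notin> bad" using ex_new_if_finite infinite_UNIV_char_0 by metis
  define u0 where "u0 = u1 - c *s u2"
  have p0: "p u0 = w1 - smult c w2" unfolding u0_def p_lin w1_def w2_def ..
  \<comment> \<open>The ratio of the top coefficients was put into \<open>bad\<close>, so they do
    not cancel; if \<open>coeff w2 m = 0\<close>, there is nothing to cancel.\<close>
  have top0: "coeff (p u0) m \<noteq> 0"
    using c u1 unfolding bad_def p0 w1_def[symmetric] by (cases "coeff w2 m = 0") (auto simp: field_simps)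
  have "poly (pderiv (p u0)) z \<noteq> 0" if z: "poly (p u0) z = 0" for z
  proof
    assume "poly (pderiv (p u0)) z = 0"
    then have d: "poly (pderiv w1) z = c * poly (pderiv w2) z"
      unfolding p0 by (simp add: pderiv_diff pderiv_smult)
    have v: "poly w1 z = c * poly w2 z" using z unfolding p0 by simp
    then have "poly w2 z \<noteq> 0" using no_common by auto
    then have "c = poly w1 z / poly w2 z" using v by simp
    moreover have "poly W z = 0" unfolding W_def by (simp add: d v)
    ultimately show False using c unfolding bad_def by auto
  qed
  from simple_roots_open[OF form_coeff degree_eq[OF top0] deg_p this] obtain e R where
    R: "form e R" "R u0 \<noteq> 0" "\<And>u z. R u \<noteq> 0 \<Longrightarrow> degree (p u) = m \<Longrightarrow> poly (p u) z = 0 \<Longrightarrow>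
      poly (pderiv (p u)) z \<noteq> 0"
    by blast
  show ?thesis
  proof (intro exI conjI allI impI)
    show "form (e + 1) (\<lambda>u. R u * coeff (p u) m)" by (intro form.mult R form_coeff)
    show "R u0 * coeff (p u0) m \<noteq> 0" using R(2) top0 by simp
    fix u assume u: "R u * coeff (p u) m \<noteq> 0"
    then show "coeff (p u) m \<noteq> 0" by simp
    then have "degree (p u) = m" "p u \<noteq> 0" using degree_eq by auto
    then show "card {z. poly (p u) z = 0} = m"
      using card_simple_roots[of "p u"] R(3)[of u] u by auto
  qed
qed

subsection \<open>Pluecker coordinates\<close>

text \<open>The library enumerates the index type as 1, 2, 3, 4; arithmetic in it is modulo 4, so 4
  is the index 0.\<close>

lemma all_4: "(\<forall>i::4. P i) \<longleftrightarrow> P 0 \<and> P 1 \<and> P 2 \<and> P 3"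
proof -
  have "(4 :: 4) = 0" by simp
  then show ?thesis unfolding forall_4 by (simp only: conj_ac)
qed

lemma all_6: "(\<forall>i::6. P i) \<longleftrightarrow> P 0 \<and> P 1 \<and> P 2 \<and> P 3 \<and> P 4 \<and> P 5"
proof -
  have "{0, 1, 2, 3, 4, 5 :: 6} = UNIV"
    by (rule card_subset_eq) simp_all
  then have "(\<forall>i::6. P i) \<longleftrightarrow> (\<forall>i\<in>{0, 1, 2, 3, 4, 5}. P i)"
    by (metis UNIV_I)
  then show ?thesis by simp
qed

lemma vec4_nth [simp]:
  "vec4 a b c d $ 0 = a" "vec4 a b c d $ 1 = b" "vec4 a b c d $ 2 = c" "vec4 a b c d $ 3 = d"
  by (simp_all add: vec4_def)

lemma vec4_eq_0 [simp]: "vec4 a b c d = 0 \<longleftrightarrow> a = 0 \<and> b = 0 \<and> c = 0 \<and> d = 0"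
  by (simp add: vec_eq_iff all_4)

lemma pluecker_nth [simp]:
  "pluecker x y $ 0 = x $ 0 * y $ 1 - x $ 1 * y $ 0"
  "pluecker x y $ 1 = x $ 0 * y $ 2 - x $ 2 * y $ 0"
  "pluecker x y $ 2 = x $ 0 * y $ 3 - x $ 3 * y $ 0"
  "pluecker x y $ 3 = x $ 1 * y $ 2 - x $ 2 * y $ 1"
  "pluecker x y $ 4 = x $ 1 * y $ 3 - x $ 3 * y $ 1"
  "pluecker x y $ 5 = x $ 2 * y $ 3 - x $ 3 * y $ 2"
  by (simp_all add: pluecker_def Let_def)

lemma pluecker_scale: "pluecker (c *s x) (d *s y) = (c * d) *s pluecker x y"
  by (simp add: vec_eq_iff all_6 algebra_simps)

text \<open>The sign is moved into a vector so that the second spanning point, too, can be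
  recognized as a point of the line.\<close>

lemma pluecker_swap: "pluecker y ((- 1) *s x) = pluecker x y"
  by (simp add: vec_eq_iff all_6 algebra_simps)

lemma pluecker_0 [simp]: "pluecker 0 y = 0" "pluecker x 0 = 0"
  by (simp_all add: vec_eq_iff all_6)

lemma pluecker_add_mult: "pluecker x (y + c *s x) = pluecker x y"
  by (simp add: vec_eq_iff all_6 algebra_simps)

lemma pluecker_eq_0_imp:
  assumes "x \<noteq> 0" "y \<noteq> 0" "pluecker x y = 0"
  shows "pt x = pt y"
proof -
  have *: "\<forall>i j. x $ i * y $ j = x $ j * y $ i"
    using assms(3) unfolding vec_eq_iff all_6 all_4 by (simp add: mult.commute)
  obtain i where i: "x $ i \<noteq> 0" using assms(1) by (auto simp: vec_eq_iff)
  have eq: "y = (y $ i / x $ i) *s x"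
    using *[rule_format, of i] i by (simp add: vec_eq_iff field_simps)
  then have "y $ i / x $ i \<noteq> 0" using assms(2) by (metis vector_smult_lzero)
  from pt_scale[OF this, of x] show ?thesis using eq by simp
qed

lemma pt_eq_imp_pluecker:
  assumes "x \<noteq> 0" "y \<noteq> 0" "pt x = pt y"
  shows "pluecker x y = 0"
  using pt_eqD[OF assms(3,1,2)] by (auto simp: vec_eq_iff all_6)

lemma join_pt:
  assumes "x \<noteq> 0" "y \<noteq> 0"
  shows "join (pt x) (pt y) = pt (pluecker x y)"
  by (rule rep_ptE[OF assms(1)], rule rep_ptE[OF assms(2)])
    (simp add: join_def pluecker_scale pt_scale)

lemma points_of_pt_pluecker:
  assumes "pluecker x y \<noteq> 0"
  shows "pt x \<in> points_of (pt (pluecker x y))"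
proof -
  have nz: "x \<noteq> 0" "y \<noteq> 0" using assms by auto
  then have "pt y \<noteq> pt x" using pt_eq_imp_pluecker assms by metis
  then show ?thesis
    unfolding points_of_def mem_Collect_eq join_pt[OF nz, symmetric] by fastforce
qed

lemma points_ofE:
  assumes "pt x \<in> points_of l" "x \<noteq> 0"
  obtains y where "pluecker x y \<noteq> 0" "l = pt (pluecker x y)"
proof -
  obtain Q where Q: "Q \<noteq> pt x" "l = join (pt x) Q"
    using assms(1) unfolding points_of_def by blast
  obtain y where y: "y \<noteq> 0" "Q = pt y" by (rule pspace_cases)
  show ?thesis
  proof (rule that)
    show "l = pt (pluecker x y)" using Q y join_pt assms(2) by simp
    show "pluecker x y \<noteq> 0" using Q y pluecker_eq_0_imp assms(2) by metis
  qed
qed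

lemma GrE:
  assumes "l \<in> Gr"
  obtains x y where "pluecker x y \<noteq> 0" "l = pt (pluecker x y)"
proof -
  obtain P Q where PQ: "P \<noteq> Q" "l = join P Q" using assms unfolding Gr_def by blast
  obtain x where x: "x \<noteq> 0" "P = pt x" by (rule pspace_cases)
  have "pt x \<in> points_of l" using PQ x unfolding points_of_def by (auto intro: exI[of _ Q])
  then show ?thesis using points_ofE[OF _ x(1)] that by blast
qed

lemma pt_in_plane:
  assumes "u \<noteq> 0" "x \<noteq> 0"
  shows "pt x \<in> plane (pt u) \<longleftrightarrow>
    u $ 0 * x $ 0 + u $ 1 * x $ 1 + u $ 2 * x $ 2 + u $ 3 * x $ 3 = 0"
proof -
  obtain c where c: "c \<noteq> 0" "rep_pspace (pt u) = c *s u" by (rule rep_ptE[OF assms(1)])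
  obtain d where d: "d \<noteq> 0" "rep_pspace (pt x) = d *s x" by (rule rep_ptE[OF assms(2)])
  have "(\<Sum>i\<in>UNIV. rep_pspace (pt u) $ i * rep_pspace (pt x) $ i) =
      c * d * (\<Sum>i\<in>UNIV. u $ i * x $ i)"
    by (simp add: c d sum_distrib_left mult_ac)
  also have "(\<Sum>i\<in>UNIV. u $ i * x $ i) =
      u $ 0 * x $ 0 + u $ 1 * x $ 1 + u $ 2 * x $ 2 + u $ 3 * x $ 3"
  proof -
    have "(4 :: 4) = 0" by simp
    then show ?thesis unfolding sum_4 by (simp only: add_ac)
  qed
  finally show ?thesis using c(1) d(1) by (simp add: plane_def)
qed

text \<open>\<open>line_meeting_L s t a b r\<close> is the line through \<open>(0 : 0 : a : b)\<close> and any point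
  \<open>(s : t : y : z)\<close> with \<open>y b - z a = r\<close>.\<close>

definition line_meeting_L :: "complex \<Rightarrow> complex \<Rightarrow> complex \<Rightarrow> complex \<Rightarrow> complex \<Rightarrow> complex ^ 6"
  where "line_meeting_L s t a b r = (\<chi> k. if k = 0 then 0 else if k = 1 then s * a
    else if k = 2 then s * b else if k = 3 then t * a else if k = 4 then t * b else r)"

lemma line_meeting_L_nth [simp]:
  "line_meeting_L s t a b r $ 0 = 0"
  "line_meeting_L s t a b r $ 1 = s * a"
  "line_meeting_L s t a b r $ 2 = s * b"
  "line_meeting_L s t a b r $ 3 = t * a"
  "line_meeting_L s t a b r $ 4 = t * b"
  "line_meeting_L s t a b r $ 5 = r"
  by (simp_all add: line_meeting_L_def)

lemma pluecker_L:
  "pluecker v (vec4 0 0 a b) = line_meeting_L (v $ 0) (v $ 1) a b (v $ 2 * b - v $ 3 * a)"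
  by (simp add: vec_eq_iff all_6)

lemma line_meeting_L_nonzero:
  "(s, t) \<noteq> (0, 0) \<Longrightarrow> (a, b) \<noteq> (0, 0) \<Longrightarrow> line_meeting_L s t a b r \<noteq> 0"
  by (auto simp: vec_eq_iff all_6)

lemma line_meeting_L_scale:
  "line_meeting_L (k * s) (k * t) a b (k * r) = k *s line_meeting_L s t a b r"
  "line_meeting_L s t (k * a) (k * b) (k * r) = k *s line_meeting_L s t a b r"
  by (simp_all add: vec_eq_iff all_6)

text \<open>The vanishing of the coordinate 01 is the condition for meeting \<open>L\<close>: a
  multiple of \<open>x\<close> can be subtracted from \<open>y\<close> to clear both coordinates 0
  and 1, which moves the second spanning point onto \<open>L\<close>.\<close>

lemma meets_L_through:
  assumes "pluecker x y $ 0 = 0" "(x $ 0, x $ 1) \<noteq> (0, 0)"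
  shows "\<exists>a b. pluecker x y = pluecker x (vec4 0 0 a b)"
proof -
  define c where "c = (if x $ 0 = 0 then y $ 1 / x $ 1 else y $ 0 / x $ 0)"
  define z where "z = y + (- c) *s x"
  have "z $ 0 = 0" "z $ 1 = 0"
    using assms by (auto simp: z_def c_def field_simps)
  then have "z = vec4 0 0 (z $ 2) (z $ 3)" by (simp add: vec_eq_iff all_4)
  moreover have "pluecker x z = pluecker x y" unfolding z_def by (rule pluecker_add_mult)
  ultimately show ?thesis by metis
qed

lemma meets_L:
  assumes "pluecker x y $ 0 = 0"
  shows "\<exists>v a b. pluecker x y = pluecker v (vec4 0 0 a b)"
proof (cases "(x $ 0, x $ 1) = (0, 0)")
  case True
  have "pluecker x y = pluecker ((- 1) *s y) (vec4 0 0 (x $ 2) (x $ 3))"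
    using True by (simp add: vec_eq_iff all_6)
  then show ?thesis by blast
next
  case False
  then show ?thesis using meets_L_through[OF assms] by blast
qed

text \<open>A plane with \<open>u $ 2 \<noteq> 0\<close> meets \<open>L\<close> only in
  \<open>(0 : 0 : u_3 : -u_2)\<close>, and the last argument is the value of \<open>r\<close> that
  puts the points \<open>(s : t : y : z)\<close> of the line into the plane.\<close>

lemma points_of_line_meeting_L_subset_plane:
  assumes "(s, t) \<noteq> (0, 0)" "u $ 2 \<noteq> 0"
  shows "points_of (pt (line_meeting_L s t (u $ 3) (- u $ 2) (u $ 0 * s + u $ 1 * t))) \<subseteq> plane (pt u)"
proof
  let ?p = "line_meeting_L s t (u $ 3) (- u $ 2) (u $ 0 * s + u $ 1 * t)"
  fix P assume P: "P \<in> points_of (pt ?p)"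
  obtain x where x: "x \<noteq> 0" "P = pt x" by (rule pspace_cases)
  obtain y where y: "pluecker x y \<noteq> 0" "pt ?p = pt (pluecker x y)"
    using points_ofE[OF P[unfolded x(2)] x(1)] by blast
  have "?p \<noteq> 0" using assms by (intro line_meeting_L_nonzero) auto
  from pt_eqD[OF y(2) this y(1)] obtain k where k: "k \<noteq> 0" "?p = k *s pluecker x y" by blast
  have p: "?p $ i = k * pluecker x y $ i" for i
    using arg_cong[OF k(2), of "\<lambda>v. v $ i"] by simp
  \<comment> \<open>Three of the four linear incidence relations between a point and the Pluecker
    coordinates of a line through it.\<close>
  have *: "x $ 0 * ?p $ 5 - x $ 2 * ?p $ 2 + x $ 3 * ?p $ 1 = 0"
    "x $ 1 * ?p $ 5 - x $ 2 * ?p $ 4 + x $ 3 * ?p $ 3 = 0"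
    "x $ 0 * ?p $ 4 - x $ 1 * ?p $ 2 + x $ 3 * ?p $ 0 = 0"
    unfolding p by (simp_all add: algebra_simps)
  let ?e = "u $ 0 * x $ 0 + u $ 1 * x $ 1 + u $ 2 * x $ 2 + u $ 3 * x $ 3"
  have "x $ 0 * t = x $ 1 * s" using *(3) assms(2) by (auto simp: algebra_simps)
  then have "s * ?e = 0" "t * ?e = 0"
    using *(1,2) by (simp_all, algebra+)
  then have "?e = 0" using assms(1) by auto
  moreover have "u \<noteq> 0" using assms(2) by auto
  ultimately show "P \<in> plane (pt u)" using pt_in_plane x by simp
qed

subsection \<open>The congruence of lines meeting the curve and L\<close>

locale parametrized_curve =
  fixes \<beta> :: nat and f g h :: "complex \<Rightarrow> complex \<Rightarrow> complex"
  assumes \<beta>: "\<beta> \<ge> 1"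
    and f: "binary_form (\<beta> - 1) f" and g: "binary_form \<beta> g" and h: "binary_form \<beta> h"
    and f_nonzero: "\<exists>s t. f s t \<noteq> 0"
    and no_common_zero: "(s, t) \<noteq> (0, 0) \<Longrightarrow>
      \<not> (s * f s t = 0 \<and> t * f s t = 0 \<and> g s t = 0 \<and> h s t = 0)"
begin

abbreviation "X \<equiv> curve_X f g h"
abbreviation "C \<equiv> join_congruence X line_L"
abbreviation "curve_point s t \<equiv> vec4 (s * f s t) (t * f s t) (g s t) (h s t)"

section \<open>Zeros of \<open>f\<close>, which give the points of \<open>X\<close> on
  \<open>L\<close>\<close>

lemma gh_nonzero: "(s, t) \<noteq> (0, 0) \<Longrightarrow> f s t = 0 \<Longrightarrow> (g s t, h s t) \<noteq> (0, 0)"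
  using no_common_zero by auto

text \<open>\<open>Z\<close> represents the zeros of \<open>f\<close> on the projective line up to
  scaling: the roots in the chart \<open>t = 1\<close>, and \<open>(1, 0)\<close> if
  \<open>f\<close> vanishes at infinity.\<close>

lemma zeros_f:
  "\<exists>Z. finite Z \<and> (\<forall>s t. (s, t) \<in> Z \<longrightarrow> (s, t) \<noteq> (0, 0) \<and> f s t = 0) \<and>
    (\<forall>s t. (s, t) \<noteq> (0, 0) \<longrightarrow> f s t = 0 \<longrightarrow>
      (\<exists>k s' t'. k \<noteq> 0 \<and> (s', t') \<in> Z \<and> s = k * s' \<and> t = k * t'))"
proof -
  obtain F where F: "degree F \<le> \<beta> - 1" "\<And>z. poly F z = f z 1" "coeff F (\<beta> - 1) = f 1 0"
    using binary_form_poly[OF f] by blast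
  have dehom: "f s t = t ^ (\<beta> - 1) * f (s / t) 1" if "t \<noteq> 0" for s t
    using binary_form_scale[OF f, of t "s / t" 1] that by simp
  have at_infinity: "f s 0 = s ^ (\<beta> - 1) * f 1 0" for s
    using binary_form_scale[OF f, of s 1 0] by simp
  have "F \<noteq> 0"
  proof
    assume "F = 0"
    then have "f s t = 0" for s t
      using F(2,3) dehom[of t s] at_infinity[of s] by (cases "t = 0") auto
    then show False using f_nonzero by blast
  qed
  define Z :: "(complex \<times> complex) set"
    where "Z = (\<lambda>z. (z, 1)) ` {z. poly F z = 0} \<union> (if f 1 0 = 0 then {(1, 0)} else {})"
  show ?thesis
  proof (intro exI[of _ Z] conjI allI impI)
    show "finite Z" unfolding Z_def using poly_roots_finite[OF \<open>F \<noteq> 0\<close>] by simp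
    show "(s, t) \<noteq> (0, 0)" "f s t = 0" if "(s, t) \<in> Z" for s t
      using that unfolding Z_def by (auto simp: F(2) split: if_splits)
    show "\<exists>k s' t'. k \<noteq> 0 \<and> (s', t') \<in> Z \<and> s = k * s' \<and> t = k * t'"
      if "(s, t) \<noteq> (0, 0)" "f s t = 0" for s t
    proof (cases "t = 0")
      case True
      then have "s \<noteq> 0" "(1, 0) \<in> Z" using that at_infinity[of s] unfolding Z_def by auto
      then show ?thesis using True by (intro exI[of _ s] exI[of _ 1] exI[of _ 0]) simp
    next
      case False
      then have "(s / t, 1) \<in> Z" using that dehom[of t s] unfolding Z_def by (auto simp: F(2))
      then show ?thesis using False by (intro exI[of _ t] exI[of _ "s / t"] exI[of _ 1]) simp
    qed
  qed
qed

text \<open>A curve point on \<open>L\<close> comes from a zero of \<open>f\<close> and equals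
  \<open>(0 : 0 : g : h)\<close>; the second assumption says that \<open>(a, b)\<close> is not
  proportional to \<open>(g, h)\<close> there.\<close>

lemma L_point_notin_X:
  assumes "(a, b) \<noteq> (0, 0)"
    and "\<And>s t. (s, t) \<noteq> (0, 0) \<Longrightarrow> f s t = 0 \<Longrightarrow> a * h s t - b * g s t \<noteq> 0"
  shows "pt (vec4 0 0 a b) \<notin> X"
proof
  assume "pt (vec4 0 0 a b) \<in> X"
  then obtain s t where st: "(s, t) \<noteq> (0, 0)" "pt (vec4 0 0 a b) = pt (curve_point s t)"
    unfolding curve_X_def by blast
  have "curve_point s t \<noteq> 0" using no_common_zero[OF st(1)] by simp
  moreover have "vec4 0 0 a b \<noteq> 0" using assms(1) by simp
  ultimately obtain c where c: "c \<noteq> 0" "vec4 0 0 a b = c *s curve_point s t"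
    using pt_eqD[OF st(2)] by blast
  then have "f s t = 0" "a = c * g s t" "b = c * h s t"
    using st(1) by (auto simp: vec_eq_iff all_4)
  then show False using assms(2)[OF st(1)] by simp
qed

text \<open>Makes it an open condition that the point \<open>(0 : 0 : p : q)\<close> of
  \<open>L\<close> avoids \<open>X\<close>: \<open>R\<close> is a product with one factor for each
  of the finitely many zeros of \<open>f\<close>. The last assumption says that no linear relation
  ties \<open>p\<close> to \<open>q\<close>, so no factor is zero.\<close>

lemma avoid_zeros_form:
  fixes p q :: "complex ^ 'n \<Rightarrow> complex"
  assumes "form d p" "form d q" "\<And>v w. (v, w) \<noteq> (0, 0) \<Longrightarrow> \<exists>x. p x * w - q x * v \<noteq> 0"
  shows "\<exists>e R. form e R \<and> (\<exists>x. R x \<noteq> 0) \<and> (\<forall>x s t. R x \<noteq> 0 \<longrightarrow> (s, t) \<noteq> (0, 0) \<longrightarrow> f s t = 0 \<longrightarrow>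
    p x * h s t - q x * g s t \<noteq> 0)"
proof -
  obtain Z where Z: "finite Z" "\<And>s t. (s, t) \<in> Z \<Longrightarrow> (s, t) \<noteq> (0, 0) \<and> f s t = 0"
    "\<And>s t. (s, t) \<noteq> (0, 0) \<Longrightarrow> f s t = 0 \<Longrightarrow>
      \<exists>k s' t'. k \<noteq> 0 \<and> (s', t') \<in> Z \<and> s = k * s' \<and> t = k * t'"
    using zeros_f by metis
  define r where "r z x = h (fst z) (snd z) * p x - g (fst z) (snd z) * q x" for z x
  have "form d (r z)" for z
    unfolding r_def by (intro form_minus form_cmult assms)
  moreover have "\<exists>x. r z x \<noteq> 0" if "z \<in> Z" for z
    using assms(3)[OF gh_nonzero] Z(2) that unfolding r_def
    by (cases z) (auto simp: mult.commute)
  ultimately have R: "form (\<Sum>z\<in>Z. d) (\<lambda>x. \<Prod>z\<in>Z. r z x)" "\<exists>x. (\<Prod>z\<in>Z. r z x) \<noteq> 0"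
    using form_prod_nonzero[OF Z(1), of "\<lambda>_. d" r] by blast+
  have "p x * h s t - q x * g s t \<noteq> 0"
    if x: "(\<Prod>z\<in>Z. r z x) \<noteq> 0" and st: "(s, t) \<noteq> (0, 0)" "f s t = 0" for x s t
  proof -
    obtain k s' t' where k: "k \<noteq> 0" "(s', t') \<in> Z" "s = k * s'" "t = k * t'"
      using Z(3)[OF st] by blast
    have "p x * h s t - q x * g s t = k ^ \<beta> * r (s', t') x"
      unfolding k(3,4) binary_form_scale[OF g] binary_form_scale[OF h] r_def
      by (simp add: algebra_simps)
    then show ?thesis using k(1,2) x Z(1) by auto
  qed
  then show ?thesis using R by blast
qed

section \<open>Equations of the congruence\<close>

lemma joinsE:
  assumes "l \<in> {join P Q | P Q. P \<in> X - line_L \<and> Q \<in> line_L - X}"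
  obtains s t a b where "(s, t) \<noteq> (0, 0)" "(a, b) \<noteq> (0, 0)" "f s t \<noteq> 0"
    "l = pt (line_meeting_L s t a b ((g s t * b - h s t * a) / f s t))"
proof -
  obtain P Q where PQ: "P \<in> X" "P \<notin> line_L" "Q \<in> line_L" "l = join P Q" using assms by blast
  obtain s t where st: "(s, t) \<noteq> (0, 0)" "P = pt (curve_point s t)"
    using PQ(1) unfolding curve_X_def by blast
  obtain a b where ab: "(a, b) \<noteq> (0, 0)" "Q = pt (vec4 0 0 a b)"
    using PQ(3) unfolding line_L_def by blast
  have fst: "f s t \<noteq> 0"
  proof
    assume "f s t = 0"
    then have "P \<in> line_L"
      using gh_nonzero[OF st(1)] unfolding line_L_def st(2) by auto
    then show False using PQ(2) by simp
  qed
  have "curve_point s t \<noteq> 0" "vec4 0 0 a b \<noteq> 0" using no_common_zero[OF st(1)] ab(1) by auto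
  then have "l = pt (pluecker (curve_point s t) (vec4 0 0 a b))"
    unfolding PQ(4) st(2) ab(2) by (rule join_pt)
  also have "pluecker (curve_point s t) (vec4 0 0 a b) =
      f s t *s line_meeting_L s t a b ((g s t * b - h s t * a) / f s t)"
    using fst by (simp add: vec_eq_iff all_6)
  finally show ?thesis using that[OF st(1) ab(1) fst] by (simp add: pt_scale[OF fst])
qed

text \<open>Such a line is an actual join of a point of \<open>X - line_L\<close> and a point of
  \<open>line_L - X\<close>, so it belongs to \<open>C\<close> before the closure is taken.\<close>

lemma join_in_C:
  assumes "(s, t) \<noteq> (0, 0)" "(a, b) \<noteq> (0, 0)" "f s t \<noteq> 0" "pt (vec4 0 0 a b) \<notin> X"
    and r: "r * f s t = g s t * b - h s t * a"
  shows "pt (line_meeting_L s t a b r) \<in> C"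
proof -
  let ?S = "{join P Q | P Q. P \<in> X - line_L \<and> Q \<in> line_L - X}"
  have nz: "curve_point s t \<noteq> 0" "vec4 0 0 a b \<noteq> 0" using no_common_zero assms(1,2) by auto
  have "pt (curve_point s t) \<notin> line_L"
  proof
    assume "pt (curve_point s t) \<in> line_L"
    then obtain y z where yz: "(y, z) \<noteq> (0, 0)" "pt (curve_point s t) = pt (vec4 0 0 y z)"
      unfolding line_L_def by blast
    then obtain c where "curve_point s t = c *s vec4 0 0 y z"
      using pt_eqD[OF yz(2) nz(1)] by auto
    then show False using assms(1,3) by (auto simp: vec_eq_iff all_4)
  qed
  moreover have "pt (curve_point s t) \<in> X" "pt (vec4 0 0 a b) \<in> line_L"
    using assms(1,2) unfolding curve_X_def line_L_def by blast+
  ultimately have "join (pt (curve_point s t)) (pt (vec4 0 0 a b)) \<in> ?S"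
    using assms(4) by blast
  also have "join (pt (curve_point s t)) (pt (vec4 0 0 a b)) =
      pt (pluecker (curve_point s t) (vec4 0 0 a b))"
    by (rule join_pt[OF nz])
  also have "pluecker (curve_point s t) (vec4 0 0 a b) = f s t *s line_meeting_L s t a b r"
    using r by (simp add: vec_eq_iff all_6 mult.commute)
  finally have "pt (line_meeting_L s t a b r) \<in> ?S" by (simp add: pt_scale[OF assms(3)])
  moreover have "?S \<subseteq> topspace (subtopology zariski Gr)"
    unfolding topspace_subtopology topspace_zariski Gr_def by blast
  ultimately show ?thesis
    unfolding join_congruence_def using closure_of_subset by blast
qed

lemma C_E:
  assumes "l \<in> C"
  obtains x y where "pluecker x y \<noteq> 0" "pluecker x y $ 0 = 0" "l = pt (pluecker x y)"
proof -
  have "l \<in> Gr"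
    using assms unfolding join_congruence_def by (simp add: in_closure_of)
  then obtain x y where xy: "pluecker x y \<noteq> 0" "l = pt (pluecker x y)" by (rule GrE)
  have *: "form 1 (\<lambda>p :: complex ^ 6. p $ 0)" by (rule form.coord)
  have "rep_pspace l $ 0 = 0"
  proof (rule form_closure_of[OF assms[unfolded join_congruence_def] *])
    fix l' assume "l' \<in> {join P Q | P Q. P \<in> X - line_L \<and> Q \<in> line_L - X}"
    then obtain s t a b where "(s, t) \<noteq> (0, 0)" "(a, b) \<noteq> (0, 0)"
      "l' = pt (line_meeting_L s t a b ((g s t * b - h s t * a) / f s t))"
      by (rule joinsE)
    then show "rep_pspace l' $ 0 = 0"
      using form_rep_pt[OF * line_meeting_L_nonzero] by simp
  qed
  then show ?thesis
    using that xy form_rep_pt[OF * xy(1)] by simp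
qed

text \<open>The relation holds on all joins, but it is stated in parameters; to extend it to the
  closure it is rewritten as a form \<open>E\<close> in Pluecker coordinates, up to a factor that is
  1 at the given line.\<close>

lemma equation_of_C:
  assumes C: "pt (line_meeting_L s t a b r) \<in> C" and st: "(s, t) \<noteq> (0, 0)" and ab: "(a, b) \<noteq> (0, 0)"
  shows "r * f s t = g s t * b - h s t * a"
proof -
  \<comment> \<open>Supplies linear functionals with value 1 at \<open>(s, t)\<close> and at
    \<open>(a, b)\<close>; they make the extra factor of \<open>E\<close> equal to 1.\<close>
  have unit: "\<exists>k l. k * v + l * w = 1" if "(v, w) \<noteq> (0, 0)" for v w :: complex
  proof (cases "v = 0")
    case True
    then show ?thesis using that by (intro exI[of _ 0] exI[of _ "1 / w"]) simp
  next
    case False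
    then show ?thesis by (intro exI[of _ "1 / v"] exI[of _ 0]) simp
  qed
  obtain k l where kl: "k * s + l * t = 1" using unit[OF st] by blast
  obtain m n where mn: "m * a + n * b = 1" using unit[OF ab] by blast
  \<comment> \<open>For the Pluecker vector \<open>(0, s' a', s' b', t' a', t' b', r')\<close>, \<open>(S, T)\<close> is \<open>m a' + n b'\<close> times \<open>(s', t')\<close> and
    \<open>k (p_1, p_2) + l (p_3, p_4)\<close> is \<open>k s' + l t'\<close> times \<open>(a', b')\<close>; so the equation can be written as a form
    in the Pluecker coordinates.\<close>
  define S T where "S p = m * p $ 1 + n * p $ 2" and "T p = m * p $ 3 + n * p $ 4"
    for p :: "complex ^ 6"
  define E where "E p = p $ 5 * f (S p) (T p) * (k * S p + l * T p) -
    (g (S p) (T p) * (k * p $ 2 + l * p $ 4) - h (S p) (T p) * (k * p $ 1 + l * p $ 3))"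
    for p :: "complex ^ 6"
  have ST: "form 1 S" "form 1 T"
    unfolding S_def T_def by (intro form.add form_cmult form.coord)+
  have "form (1 + (\<beta> - 1) + 1) E"
    unfolding E_def
    by (intro form_minus form.mult form.add form_cmult form.coord binary_form_form[OF f] ST
        form_cong_degree[OF form.mult, of \<beta> _ 1] binary_form_form[OF g] binary_form_form[OF h])
      (use \<beta> in simp_all)
  note form_E = this
  have E: "E (line_meeting_L s' t' a' b' r') = (m * a' + n * b') ^ \<beta> * (k * s' + l * t') *
      (r' * f s' t' - (g s' t' * b' - h s' t' * a'))" for s' t' a' b' r'
  proof -
    let ?p = "line_meeting_L s' t' a' b' r'"
    define M where "M = m * a' + n * b'"
    have "S ?p = M * s'" "T ?p = M * t'" by (simp_all add: S_def T_def M_def algebra_simps)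
    moreover have "M ^ \<beta> = M ^ (\<beta> - 1) * M" using \<beta> by (cases \<beta>) auto
    ultimately show ?thesis
      unfolding E_def M_def[symmetric] by (simp add: binary_form_scale[OF f] binary_form_scale[OF g]
        binary_form_scale[OF h] algebra_simps)
  qed
  have "E (rep_pspace (pt (line_meeting_L s t a b r))) = 0"
  proof (rule form_closure_of[OF C[unfolded join_congruence_def] form_E])
    fix l' assume "l' \<in> {join P Q | P Q. P \<in> X - line_L \<and> Q \<in> line_L - X}"
    then obtain s t a b where "(s, t) \<noteq> (0, 0)" "(a, b) \<noteq> (0, 0)" "f s t \<noteq> 0"
      "l' = pt (line_meeting_L s t a b ((g s t * b - h s t * a) / f s t))"
      by (rule joinsE)
    then show "E (rep_pspace l') = 0"
      using form_rep_pt[OF form_E line_meeting_L_nonzero] by (simp add: E)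
  qed
  then have "E (line_meeting_L s t a b r) = 0"
    using form_rep_pt[OF form_E line_meeting_L_nonzero[OF st ab]] by simp
  then show ?thesis unfolding E kl mn by simp
qed

section \<open>Lines through a general point\<close>

lemma camera_eq:
  "pluecker x (curve_point (x $ 0) (x $ 1)) =
    pluecker x (vec4 0 0 (g (x $ 0) (x $ 1) - x $ 2 * f (x $ 0) (x $ 1))
      (h (x $ 0) (x $ 1) - x $ 3 * f (x $ 0) (x $ 1)))"
  \<comment> \<open>Subtracting \<open>f\<close> times \<open>x\<close> from the curve point clears
    the coordinates 0 and 1, which exhibits the point where the camera line meets
    \<open>L\<close>.\<close>
  by (simp add: vec_eq_iff all_6 algebra_simps)

lemma lines_through_point:
  fixes x :: "complex ^ 4"
  defines "a \<equiv> g (x $ 0) (x $ 1) - x $ 2 * f (x $ 0) (x $ 1)"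
    and "b \<equiv> h (x $ 0) (x $ 1) - x $ 3 * f (x $ 0) (x $ 1)"
  assumes x: "(x $ 0, x $ 1) \<noteq> (0, 0)" and fx: "f (x $ 0) (x $ 1) \<noteq> 0"
    and ab: "(a, b) \<noteq> (0, 0)" and notin: "pt (vec4 0 0 a b) \<notin> X"
  shows "pluecker x (curve_point (x $ 0) (x $ 1)) \<noteq> 0"
    and "{l \<in> C. pt x \<in> points_of l} = {pt (pluecker x (curve_point (x $ 0) (x $ 1)))}"
proof -
  let ?s = "x $ 0" and ?t = "x $ 1"
  have cam: "pluecker x (curve_point ?s ?t) = line_meeting_L ?s ?t a b (x $ 2 * b - x $ 3 * a)"
    unfolding camera_eq pluecker_L a_def b_def ..
  show nz: "pluecker x (curve_point ?s ?t) \<noteq> 0"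
    unfolding cam by (rule line_meeting_L_nonzero[OF x ab])
  have "pt (pluecker x (curve_point ?s ?t)) \<in> C"
    unfolding cam by (rule join_in_C[OF x ab fx notin]) (simp add: a_def b_def algebra_simps)
  moreover have "l = pt (pluecker x (curve_point ?s ?t))" if l: "l \<in> C" "pt x \<in> points_of l" for l
  proof -
    have "x \<noteq> 0" using x by auto
    then obtain y where y: "pluecker x y \<noteq> 0" "l = pt (pluecker x y)"
      using points_ofE[OF l(2)] by blast
    obtain x' y' where xy': "pluecker x' y' \<noteq> 0" "pluecker x' y' $ 0 = 0" "l = pt (pluecker x' y')"
      using C_E[OF l(1)] by blast
    obtain c where "c \<noteq> 0" "pluecker x y = c *s pluecker x' y'"
      using pt_eqD[OF _ y(1) xy'(1)] y(2) xy'(3) by auto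
    then have "pluecker x y $ 0 = 0" using xy'(2) by (metis mult_zero_right vector_smult_component)
    then obtain a' b' where p: "pluecker x y = pluecker x (vec4 0 0 a' b')"
      using meets_L_through[OF _ x] by blast
    then have ab': "(a', b') \<noteq> (0, 0)" using y(1) by (auto simp: vec_eq_iff all_6)
    have l': "l = pt (line_meeting_L ?s ?t a' b' (x $ 2 * b' - x $ 3 * a'))"
      unfolding y(2) p pluecker_L ..
    \<comment> \<open>With \<open>r\<close> expressed through \<open>x\<close>, the equation of
      \<open>C\<close> is linear in \<open>(a', b')\<close> and its solutions are the multiples of
      \<open>(a, b)\<close>.\<close>
    from equation_of_C[OF l(1)[unfolded l'] x ab'] have ratio: "a * b' = b * a'"
      by (simp add: a_def b_def algebra_simps)
    obtain k where k: "k \<noteq> 0" "a' = k * a" "b' = k * b"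
    proof (cases "a = 0")
      case True
      then have "a' = 0" "b \<noteq> 0" "b' \<noteq> 0" using ratio ab ab' by auto
      then show ?thesis using that[of "b' / b"] True by simp
    next
      case False
      then have "b' = a' / a * b" using ratio by (simp add: field_simps)
      moreover from this have "a' \<noteq> 0" using ab' by auto
      ultimately show ?thesis using that[of "a' / a"] False by simp
    qed
    have "l = pt (line_meeting_L ?s ?t (k * a) (k * b) (k * (x $ 2 * b - x $ 3 * a)))"
      unfolding l' k(2,3) by (simp add: algebra_simps)
    then show ?thesis unfolding line_meeting_L_scale pt_scale[OF k(1)] cam .
  qed
  moreover have "pt x \<in> points_of (pt (pluecker x (curve_point ?s ?t)))"
    by (rule points_of_pt_pluecker[OF nz])
  ultimately show "{l \<in> C. pt x \<in> points_of l} = {pt (pluecker x (curve_point ?s ?t))}"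
    by blast
qed

text \<open>The form is a product that enforces the assumptions of
  \<open>lines_through_point\<close>: \<open>x $ 0\<close> for
  \<open>(x_0, x_1) \<noteq> (0, 0)\<close>, then \<open>f\<close>, then \<open>p\<close> for a
  nonzero \<open>(p, q)\<close>, and a factor that keeps \<open>(0 : 0 : p : q)\<close> off
  \<open>X\<close>.\<close>

lemma generic_point:
  obtains d and R :: "complex ^ 4 \<Rightarrow> complex" and x0 where "form d R" "x0 \<noteq> 0" "R x0 \<noteq> 0"
    "\<And>x. R x \<noteq> 0 \<Longrightarrow> pluecker x (curve_point (x $ 0) (x $ 1)) \<noteq> 0 \<and>
      {l \<in> C. pt x \<in> points_of l} = {pt (pluecker x (curve_point (x $ 0) (x $ 1)))}"
proof -
  let ?f = "\<lambda>x :: complex ^ 4. f (x $ 0) (x $ 1)"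
  define p q where "p x = g (x $ 0) (x $ 1) - x $ 2 * ?f x" and "q x = h (x $ 0) (x $ 1) - x $ 3 * ?f x"
    for x :: "complex ^ 4"
  have fF: "form (\<beta> - 1) ?f" by (intro binary_form_form[OF f] form.coord)
  have form_mult_f: "form \<beta> (\<lambda>x. x $ i * ?f x)" for i
    by (rule form_cong_degree[OF form.mult[OF form.coord fF]]) (use \<beta> in simp)
  have pq: "form \<beta> p" "form \<beta> q"
    unfolding p_def q_def
    by (intro form_minus form_mult_f binary_form_form[OF g] binary_form_form[OF h] form.coord)+
  obtain s t where st: "f s t \<noteq> 0" using f_nonzero by blast
  \<comment> \<open>Where \<open>f\<close> is nonzero, \<open>x $ 2\<close> and \<open>x $ 3\<close>
    can be solved for, so \<open>(p, q)\<close> takes every value.\<close>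
  have attain: "\<exists>x. p x = a \<and> q x = b" for a b
    by (rule exI[of _ "vec4 s t ((g s t - a) / f s t) ((h s t - b) / f s t)"])
      (simp add: p_def q_def st)
  have "\<exists>x. p x * w - q x * v \<noteq> 0" if vw: "(v, w) \<noteq> (0, 0)" for v w
  proof (cases "w = 0")
    case True
    obtain x where "p x = 0" "q x = 1" using attain by blast
    then show ?thesis using True vw by (intro exI[of _ x]) simp
  next
    case False
    obtain x where "p x = 1" "q x = 0" using attain by blast
    then show ?thesis using False by (intro exI[of _ x]) simp
  qed
  from avoid_zeros_form[OF pq this] obtain e R where R: "form e R" "\<exists>x. R x \<noteq> 0"
    "\<And>x s t. R x \<noteq> 0 \<Longrightarrow> (s, t) \<noteq> (0, 0) \<Longrightarrow> f s t = 0 \<Longrightarrow> p x * h s t - q x * g s t \<noteq> 0"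
    by metis
  have "form 1 (\<lambda>x :: complex ^ 4. x $ 0)" by (rule form.coord)
  note forms = this fF pq(1) R(1)
  have "\<exists>x :: complex ^ 4. x $ 0 \<noteq> 0" by (rule exI[of _ "vec4 1 0 0 0"]) simp
  moreover have "\<exists>x. ?f x \<noteq> 0" by (rule exI[of _ "vec4 s t 0 0"]) (simp add: st)
  ultimately have "\<exists>x. x $ 0 * ?f x \<noteq> 0" using form_mult_nonzero forms(1,2) by blast
  then have "\<exists>x. x $ 0 * ?f x * p x \<noteq> 0"
    using form_mult_nonzero[OF form.mult[OF forms(1,2)] forms(3)] attain[of 1 0] by fastforce
  then have ex: "\<exists>x. x $ 0 * ?f x * p x * R x \<noteq> 0"
    using form_mult_nonzero[OF form.mult[OF form.mult[OF forms(1,2)] forms(3)] forms(4)] R(2) by blast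
  then obtain x0 where x0: "x0 $ 0 * ?f x0 * p x0 * R x0 \<noteq> 0" by blast
  show ?thesis
  proof (rule that)
    show "form (1 + (\<beta> - 1) + \<beta> + e) (\<lambda>x. x $ 0 * ?f x * p x * R x)"
      by (intro form.mult forms)
    show "x0 $ 0 * ?f x0 * p x0 * R x0 \<noteq> 0" by fact
    then show "x0 \<noteq> 0" by auto
    fix x assume x: "x $ 0 * ?f x * p x * R x \<noteq> 0"
    then have "pt (vec4 0 0 (p x) (q x)) \<notin> X"
      by (intro L_point_notin_X R(3)) auto
    then show "pluecker x (curve_point (x $ 0) (x $ 1)) \<noteq> 0 \<and>
        {l \<in> C. pt x \<in> points_of l} = {pt (pluecker x (curve_point (x $ 0) (x $ 1)))}"
      using x lines_through_point[of x] unfolding p_def q_def by auto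
  qed
qed

section \<open>Lines in a general plane\<close>

definition plane_form :: "complex ^ 4 \<Rightarrow> complex \<Rightarrow> complex \<Rightarrow> complex"
  where "plane_form u s t = (u $ 0 * s + u $ 1 * t) * f s t + u $ 2 * g s t + u $ 3 * h s t"

lemma plane_form_scale: "plane_form u (c * s) (c * t) = c ^ \<beta> * plane_form u s t"
proof -
  have "c ^ \<beta> = c ^ (\<beta> - 1) * c" using \<beta> by (cases \<beta>) auto
  then show ?thesis
    unfolding plane_form_def binary_form_scale[OF f] binary_form_scale[OF g] binary_form_scale[OF h]
    by (simp add: algebra_simps)
qed

text \<open>\<open>plane_form u\<close> is the equation of the plane pulled back to the curve. Each
  zero gives the line joining its curve point to the point of the plane on \<open>L\<close>;
  \<open>plane_form u 1 0 \<noteq> 0\<close> keeps all zeros in the chart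
  \<open>t = 1\<close>.\<close>

lemma lines_in_plane:
  assumes u: "u $ 2 \<noteq> 0" "plane_form u 1 0 \<noteq> 0"
    and avoid: "\<And>s t. (s, t) \<noteq> (0, 0) \<Longrightarrow> f s t = 0 \<Longrightarrow> u $ 2 * g s t + u $ 3 * h s t \<noteq> 0"
  shows "card {l \<in> C. points_of l \<subseteq> plane (pt u)} = card {z. plane_form u z 1 = 0}"
proof -
  define l where "l z = line_meeting_L z 1 (u $ 3) (- u $ 2) (u $ 0 * z + u $ 1)" for z
  have "u \<noteq> 0" using u(1) by auto
  have ab: "(u $ 3, - u $ 2) \<noteq> (0, 0)" using u(1) by simp
  have notin: "pt (vec4 0 0 (u $ 3) (- u $ 2)) \<notin> X"
    by (rule L_point_notin_X[OF ab]) (use avoid in \<open>auto simp: algebra_simps\<close>)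
  have l_in: "pt (l z) \<in> C \<and> points_of (pt (l z)) \<subseteq> plane (pt u)" if z: "plane_form u z 1 = 0" for z
  proof
    have "f z 1 \<noteq> 0"
    proof
      assume "f z 1 = 0"
      then show False using avoid[of z 1] z by (simp add: plane_form_def)
    qed
    moreover have "(u $ 0 * z + u $ 1) * f z 1 = g z 1 * (- u $ 2) - h z 1 * u $ 3"
      using z by (simp add: plane_form_def eq_neg_iff_add_eq_0 algebra_simps)
    ultimately show "pt (l z) \<in> C"
      unfolding l_def by (intro join_in_C ab notin) auto
    show "points_of (pt (l z)) \<subseteq> plane (pt u)"
      using points_of_line_meeting_L_subset_plane[of z 1 u] u(1) by (simp add: l_def)
  qed
  have "inj_on (\<lambda>z. pt (l z)) {z. plane_form u z 1 = 0}"
  proof (rule inj_onI)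
    fix z z' assume eq: "pt (l z) = pt (l z')"
    have "l z \<noteq> 0" "l z' \<noteq> 0" unfolding l_def by (intro line_meeting_L_nonzero ab; simp)+
    then obtain c where "l z = c *s l z'" using pt_eqD[OF eq] by blast
    \<comment> \<open>Coordinate 4 is \<open>- u $ 2\<close> on both sides and forces
      \<open>c = 1\<close>; coordinate 2 then compares \<open>z\<close> with
      \<open>z'\<close>.\<close>
    then have "l z $ 4 = c * l z' $ 4" "l z $ 2 = c * l z' $ 2" by simp_all
    then show "z = z'" using u(1) by (simp add: l_def)
  qed
  moreover have "{l \<in> C. points_of l \<subseteq> plane (pt u)} = (\<lambda>z. pt (l z)) ` {z. plane_form u z 1 = 0}"
  proof (intro equalityI subsetI)
    fix m assume "m \<in> {l \<in> C. points_of l \<subseteq> plane (pt u)}"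
    then have m: "m \<in> C" "points_of m \<subseteq> plane (pt u)" by auto
    obtain x y where xy: "pluecker x y \<noteq> 0" "pluecker x y $ 0 = 0" "m = pt (pluecker x y)"
      using C_E[OF m(1)] by blast
    obtain v a b where v: "pluecker x y = pluecker v (vec4 0 0 a b)"
      using meets_L[OF xy(2)] by blast
    let ?w = "vec4 0 0 a b"
    have nz: "pluecker v ?w \<noteq> 0" "v \<noteq> 0" "?w \<noteq> 0" using xy(1) v pluecker_0 by metis+
    have mv: "m = pt (pluecker v ?w)" using xy(3) v by simp
    have mw: "m = pt (pluecker ?w ((- 1) *s v))"
      unfolding mv pluecker_swap ..
    have "pluecker ?w ((- 1) *s v) \<noteq> 0" unfolding pluecker_swap by (rule nz(1))
    then have "pt v \<in> plane (pt u)" "pt ?w \<in> plane (pt u)"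
      using m(2) points_of_pt_pluecker[OF nz(1)] points_of_pt_pluecker[of ?w "(- 1) *s v"] mv mw by auto
    then have uv: "u $ 0 * v $ 0 + u $ 1 * v $ 1 + u $ 2 * v $ 2 + u $ 3 * v $ 3 = 0"
      and uw: "u $ 2 * a + u $ 3 * b = 0"
      using pt_in_plane[OF \<open>u \<noteq> 0\<close> nz(2)] pt_in_plane[OF \<open>u \<noteq> 0\<close> nz(3)] by auto
    define k where "k = - b / u $ 2"
    have k: "a = k * u $ 3" "b = k * (- u $ 2)" using uw u(1)
      by (auto simp: k_def field_simps eq_neg_iff_add_eq_0)
    have "k \<noteq> 0" using nz(3) k by auto
    define r where "r = u $ 0 * v $ 0 + u $ 1 * v $ 1"
    have "v $ 2 * b - v $ 3 * a = k * r"
      using uv by (simp add: r_def k) algebra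
    then have "pluecker v ?w = line_meeting_L (v $ 0) (v $ 1) (k * u $ 3) (k * (- u $ 2)) (k * r)"
      by (simp only: pluecker_L k[symmetric])
    then have m_eq: "m = pt (line_meeting_L (v $ 0) (v $ 1) (u $ 3) (- u $ 2) r)"
      unfolding mv by (simp only: line_meeting_L_scale pt_scale[OF \<open>k \<noteq> 0\<close>])
    \<comment> \<open>If \<open>v\<close> were on \<open>L\<close>, both spanning points would be
      the one point of the plane on \<open>L\<close>, and the Pluecker vector would vanish.\<close>
    have v01: "(v $ 0, v $ 1) \<noteq> (0, 0)"
    proof
      assume v0: "(v $ 0, v $ 1) = (0, 0)"
      then have "r = 0" by (simp add: r_def)
      then have "pluecker v ?w = 0"
        using v0 \<open>v $ 2 * b - v $ 3 * a = k * r\<close> by (simp add: vec_eq_iff all_6)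
      then show False using nz(1) by simp
    qed
    have "plane_form u (v $ 0) (v $ 1) = 0"
      using equation_of_C[OF m(1)[unfolded m_eq] v01 ab] by (simp add: plane_form_def r_def)
    moreover have "v $ 1 \<noteq> 0"
    proof
      assume "v $ 1 = 0"
      then show False
        using plane_form_scale[of u "v $ 0" 1 0] v01 u(2) \<open>plane_form u (v $ 0) (v $ 1) = 0\<close> by simp
    qed
    ultimately have "plane_form u (v $ 0 / v $ 1) 1 = 0"
      using plane_form_scale[of u "v $ 1" "v $ 0 / v $ 1" 1] by simp
    moreover have "m = pt (l (v $ 0 / v $ 1))"
    proof -
      have "line_meeting_L (v $ 0) (v $ 1) (u $ 3) (- u $ 2) r = v $ 1 *s l (v $ 0 / v $ 1)"
        unfolding l_def r_def using \<open>v $ 1 \<noteq> 0\<close> by (simp add: vec_eq_iff all_6 field_simps)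
      then show ?thesis unfolding m_eq by (simp add: pt_scale[OF \<open>v $ 1 \<noteq> 0\<close>])
    qed
    ultimately show "m \<in> (\<lambda>z. pt (l z)) ` {z. plane_form u z 1 = 0}" by blast
  qed (use l_in in auto)
  ultimately show ?thesis by (simp add: card_image)
qed

text \<open>The factors of the form ensure that the plane does not contain \<open>L\<close>, that
  \<open>plane_form u\<close> has \<open>\<beta>\<close> distinct zeros, none at infinity, and that
  the point of the plane on \<open>L\<close> is not on \<open>X\<close>.\<close>

lemma generic_plane:
  obtains d and R :: "complex ^ 4 \<Rightarrow> complex" and u0 where "form d R" "u0 \<noteq> 0" "R u0 \<noteq> 0"
    "\<And>u. R u \<noteq> 0 \<Longrightarrow> card {l \<in> C. points_of l \<subseteq> plane (pt u)} = \<beta>"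
proof -
  obtain F where F: "degree F \<le> \<beta> - 1" "\<And>z. poly F z = f z 1" "coeff F (\<beta> - 1) = f 1 0"
    using binary_form_poly[OF f] by blast
  obtain G where G: "degree G \<le> \<beta>" "\<And>z. poly G z = g z 1" "coeff G \<beta> = g 1 0"
    using binary_form_poly[OF g] by blast
  obtain H where H: "degree H \<le> \<beta>" "\<And>z. poly H z = h z 1" "coeff H \<beta> = h 1 0"
    using binary_form_poly[OF h] by blast
  \<comment> \<open>The linear system cut out by planes: \<open>s f\<close>, \<open>t f\<close>,
    \<open>g\<close>, \<open>h\<close> at \<open>t = 1\<close>, with \<open>pCons 0 F\<close> for
    \<open>s f\<close>.\<close>
  define b :: "4 \<Rightarrow> complex poly" where
    "b i = (if i = 0 then pCons 0 F else if i = 1 then F else if i = 2 then G else H)" for i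
  have b [simp]: "b 0 = pCons 0 F" "b 1 = F" "b 2 = G" "b 3 = H"
    by (simp_all add: b_def)
  define p where "p u = (\<Sum>i\<in>UNIV. smult (u $ i) (b i))" for u :: "complex ^ 4"
  have "(4 :: 4) = 0" by simp
  then have p_eq: "p u = smult (u $ 1) F + smult (u $ 2) G + smult (u $ 3) H + smult (u $ 0) (pCons 0 F)" for u
    unfolding p_def sum_4 \<open>4 = 0\<close> by simp
  have "coeff F \<beta> = 0" "coeff (pCons 0 F) \<beta> = f 1 0"
    using F \<beta> by (auto intro!: coeff_eq_0 simp: coeff_pCons split: nat.splits)
  then have top: "coeff (p u) \<beta> = plane_form u 1 0" for u
    unfolding p_eq coeff_add coeff_smult by (simp add: G H plane_form_def)
  have poly_p: "poly (p u) z = plane_form u z 1" for u z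
    unfolding p_eq by (simp add: F G H plane_form_def algebra_simps)
  have "\<forall>i. degree (b i) \<le> \<beta>"
  proof -
    have "degree (pCons 0 F) \<le> \<beta>" "degree F \<le> \<beta>"
      using F(1) \<beta> by auto
    then show ?thesis unfolding all_4 b using G(1) H(1) by blast
  qed
  then have deg: "\<And>i. degree (b i) \<le> \<beta>" by blast
  \<comment> \<open>Freeness from base points at infinity gives the index \<open>i0\<close>; at the
    finite points it gives \<open>base\<close>.\<close>
  have "\<not> (\<forall>i. coeff (b i) \<beta> = 0)"
    using no_common_zero[of 1 0] \<open>coeff (pCons 0 F) \<beta> = f 1 0\<close> by (auto simp: all_4 G H)
  then obtain i0 where i0: "coeff (b i0) \<beta> \<noteq> 0" by blast
  have "\<not> (\<forall>i. poly (b i) z = 0)" for z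
    using no_common_zero[of z 1] by (auto simp: all_4 F G H)
  then have base: "\<And>z. \<exists>i. poly (b i) z \<noteq> 0" by blast
  obtain e and R :: "complex ^ 4 \<Rightarrow> complex" where eR: "form e R \<and> (\<exists>u. R u \<noteq> 0) \<and> (\<forall>u. R u \<noteq> 0 \<longrightarrow>
      plane_form u 1 0 \<noteq> 0 \<and> card {z. plane_form u z 1 = 0} = \<beta>)"
    using linear_system_generic_simple[OF deg i0 \<beta> base, folded p_def, unfolded top poly_p]
    by (elim exE)
  then have R: "form e R" "\<exists>u. R u \<noteq> 0"
    "\<And>u. R u \<noteq> 0 \<Longrightarrow> plane_form u 1 0 \<noteq> 0 \<and> card {z. plane_form u z 1 = 0} = \<beta>"
    by simp_all
  \<comment> \<open>The pair \<open>(u_3, -u_2)\<close> is the point of the plane on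
    \<open>L\<close>.\<close>
  have forms: "form 1 (\<lambda>u :: complex ^ 4. u $ 3)" "form 1 (\<lambda>u :: complex ^ 4. - 1 * u $ 2)"
    by (intro form_cmult form.coord)+
  have "\<exists>u :: complex ^ 4. u $ 3 * w - - 1 * u $ 2 * v \<noteq> 0" if "(v, w) \<noteq> (0, 0)" for v w
  proof (cases "w = 0")
    case True
    then show ?thesis using that by (intro exI[of _ "vec4 0 0 1 0"]) auto
  next
    case False
    then show ?thesis by (intro exI[of _ "vec4 0 0 0 1"]) auto
  qed
  from avoid_zeros_form[OF forms this] obtain e' and R' :: "complex ^ 4 \<Rightarrow> complex" where
    "form e' R' \<and> (\<exists>u. R' u \<noteq> 0) \<and>
      (\<forall>u s t. R' u \<noteq> 0 \<longrightarrow> (s, t) \<noteq> (0, 0) \<longrightarrow> f s t = 0 \<longrightarrow> u $ 3 * h s t - - 1 * u $ 2 * g s t \<noteq> 0)"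
    by blast
  then have R': "form e' R'" "\<exists>u. R' u \<noteq> 0"
    and avoid: "\<And>u s t. R' u \<noteq> 0 \<Longrightarrow> (s, t) \<noteq> (0, 0) \<Longrightarrow> f s t = 0 \<Longrightarrow> u $ 2 * g s t + u $ 3 * h s t \<noteq> 0"
    by (simp_all add: add.commute)
  have u2: "form 1 (\<lambda>u :: complex ^ 4. u $ 2)" by (rule form.coord)
  have "\<exists>u :: complex ^ 4. u $ 2 \<noteq> 0" by (rule exI[of _ "vec4 0 0 1 0"]) simp
  then have "\<exists>u. u $ 2 * R u \<noteq> 0" using form_mult_nonzero[OF u2 R(1)] R(2) by blast
  then obtain u0 where u0: "u0 $ 2 * R u0 * R' u0 \<noteq> 0"
    using form_mult_nonzero[OF form.mult[OF u2 R(1)] R'(1)] R'(2) by blast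
  show ?thesis
  proof (rule that)
    show "form (1 + e + e') (\<lambda>u. u $ 2 * R u * R' u)" by (intro form.mult u2 R R')
    show "u0 $ 2 * R u0 * R' u0 \<noteq> 0" by fact
    then show "u0 \<noteq> 0" by auto
    fix u assume u: "u $ 2 * R u * R' u \<noteq> 0"
    then have "card {l \<in> C. points_of l \<subseteq> plane (pt u)} = card {z. plane_form u z 1 = 0}"
      using R(3)[of u] avoid[of u] by (intro lines_in_plane) auto
    then show "card {l \<in> C. points_of l \<subseteq> plane (pt u)} = \<beta>" using R(3)[of u] u by simp
  qed
qed

section \<open>The bidegree and the camera\<close>

lemma bidegree_C: "has_bidegree C 1 \<beta>"
  unfolding has_bidegree_def
proof
  obtain d R x0 where R: "form d R" "x0 \<noteq> 0" "R x0 \<noteq> 0"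
    "\<And>x. R x \<noteq> 0 \<Longrightarrow> pluecker x (curve_point (x $ 0) (x $ 1)) \<noteq> 0 \<and>
      {l \<in> C. pt x \<in> points_of l} = {pt (pluecker x (curve_point (x $ 0) (x $ 1)))}"
    using generic_point by blast
  show "generically (\<lambda>P. finite {l \<in> C. P \<in> points_of l} \<and> card {l \<in> C. P \<in> points_of l} = 1)"
    by (rule generically_form[OF R(1-3)]) (simp add: R(4))
next
  obtain d R u0 where R: "form d R" "u0 \<noteq> 0" "R u0 \<noteq> 0"
    "\<And>u. R u \<noteq> 0 \<Longrightarrow> card {l \<in> C. points_of l \<subseteq> plane (pt u)} = \<beta>"
    using generic_plane by blast
  show "generically (\<lambda>H. finite {l \<in> C. points_of l \<subseteq> plane H} \<and>
      card {l \<in> C. points_of l \<subseteq> plane H} = \<beta>)"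
  proof (rule generically_form[OF R(1-3)])
    fix u assume "R u \<noteq> 0"
    from R(4)[OF this] show "finite {l \<in> C. points_of l \<subseteq> plane (pt u)} \<and>
        card {l \<in> C. points_of l \<subseteq> plane (pt u)} = \<beta>"
      \<comment> \<open>An infinite set has \<open>card\<close> 0, so a cardinality of at least 1
        already gives finiteness.\<close>
      using \<beta> by (auto intro: card_ge_0_finite)
  qed
qed

lemma camera_C: "rational_camera_given_by C (\<lambda>x. pluecker x (curve_point (x $ 0) (x $ 1)))"
  unfolding rational_camera_given_by_def
proof
  let ?v = "\<lambda>x :: complex ^ 4. curve_point (x $ 0) (x $ 1)"
  have fF: "form (\<beta> - 1) (\<lambda>x :: complex ^ 4. f (x $ 0) (x $ 1))"
    by (intro binary_form_form[OF f] form.coord)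
  have form_mult_f: "form \<beta> (\<lambda>x :: complex ^ 4. x $ i * f (x $ 0) (x $ 1))" for i
    by (rule form_cong_degree[OF form.mult[OF form.coord fF]]) (use \<beta> in simp)
  have "form \<beta> (\<lambda>x :: complex ^ 4. g (x $ 0) (x $ 1))" "form \<beta> (\<lambda>x :: complex ^ 4. h (x $ 0) (x $ 1))"
    by (intro binary_form_form[OF g] binary_form_form[OF h] form.coord)+
  then have "\<forall>i. form \<beta> (\<lambda>x. ?v x $ i)"
    using form_mult_f by (simp add: all_4)
  then have "form (1 + \<beta>) (\<lambda>x. x $ i * ?v x $ j - x $ j * ?v x $ i)" for i j
    by (intro form_minus form.mult[OF form.coord]) auto
  then have "\<forall>k. form (1 + \<beta>) (\<lambda>x. pluecker x (?v x) $ k)"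
    by (intro all_6[THEN iffD2] conjI) (simp_all only: pluecker_nth)
  then show "\<exists>d. \<forall>k. form d (\<lambda>x. pluecker x (?v x) $ k)" ..
  obtain d R x0 where R: "form d R" "x0 \<noteq> 0" "R x0 \<noteq> 0"
    "\<And>x. R x \<noteq> 0 \<Longrightarrow> pluecker x (?v x) \<noteq> 0 \<and>
      {l \<in> C. pt x \<in> points_of l} = {pt (pluecker x (?v x))}"
    using generic_point by blast
  show "generically (\<lambda>P. \<forall>x. x \<noteq> 0 \<and> pt x = P \<longrightarrow>
      pluecker x (?v x) \<noteq> 0 \<and> {l \<in> C. P \<in> points_of l} = {pt (pluecker x (?v x))})"
  proof (rule generically_form[OF R(1-3)], intro allI impI)
    fix y x :: "complex ^ 4" assume y: "y \<noteq> 0" "R y \<noteq> 0" and x: "x \<noteq> 0 \<and> pt x = pt y"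
    \<comment> \<open>Nonvanishing of a form does not depend on the coordinate vector chosen for the
      point.\<close>
    have "R x \<noteq> 0"
      using form_rep_pt[OF R(1) y(1)] form_rep_pt[OF R(1), of x] x y(2) by simp
    from R(4)[OF this]
    show "pluecker x (?v x) \<noteq> 0 \<and> {l \<in> C. pt y \<in> points_of l} = {pt (pluecker x (?v x))}"
      unfolding conjunct2[OF x] .
  qed
qed

end

theorem proposition4p3:
  fixes \<beta> :: nat and f g h :: "complex \<Rightarrow> complex \<Rightarrow> complex"
    and X L :: "4 pspace set" and C :: "6 pspace set"
  assumes "\<beta> \<ge> 1"
    and "binary_form (\<beta> - 1) f" and "binary_form \<beta> g" and "binary_form \<beta> h"
    and "\<exists>s t. f s t \<noteq> 0"
    and no_common_zero: "\<And>s t. (s, t) \<noteq> (0, 0) \<Longrightarrow>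
      \<not> (s * f s t = 0 \<and> t * f s t = 0 \<and> g s t = 0 \<and> h s t = 0)"
  defines "L \<equiv> line_L"
    and "X \<equiv> curve_X f g h"
    and "C \<equiv> join_congruence X L"
  shows "has_bidegree C 1 \<beta> \<and>
    rational_camera_given_by C
      (\<lambda>x. pluecker x
        (vec4 (x $ 0 * f (x $ 0) (x $ 1)) (x $ 1 * f (x $ 0) (x $ 1))
              (g (x $ 0) (x $ 1)) (h (x $ 0) (x $ 1))))"
proof -
  interpret parametrized_curve \<beta> f g h
    by (rule parametrized_curve.intro; fact assms(1-6))
  show ?thesis
    unfolding C_def X_def L_def by (rule conjI[OF bidegree_C camera_C])
qed

end
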